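(* Let $d\in\mathbb{N}$, let $P$ be a stationary and ergodic probability measure on $\Omega=[0,1]^{\mathcal{K}^d}$, and fix an integer $0\le q<d$. For each $t\in[0,1]$ let $\widehat\beta_q(t)$ be the non-random constant such that $|\Lambda_n|^{-1}\beta_q^n(t)\to\widehat\beta_q(t)$ almost surely (such a constant exists for every $t$). Assume that for every $Q\in\mathcal{K}^d$ the marginal distribution function $F^Q(t)=P(\omega_Q\le t)$ is continuous in $t\in[0,1]$. Then $$\lim_{n\to\infty}\sup_{t\in[0,1]}\Big|\frac{1}{|\Lambda_n|}\beta_q^n(t)-\widehat\beta_q(t)\Big|=0\quad\text{almost surely.}$$
   Context: An elementary interval is a closed interval $[l,l+1]$ or a degenerate interval $[l]=[l,l]$ with $l\in\mathbb{Z}$. An elementary cube in $\mathbb{R}^d$ is a product $Q=I_1\times\cdots\times I_d$ of elementary intervals; its dimension is the number of nondegenerate factors. $\mathcal{K}^d$ denotes the set of all elementary cubes in $\mathbb{R}^d$. A cubical set is a (possibly infinite) union of elementary cubes. For a cubical set $X$, the cubical chain complex has $C_k(X)$ the free $\mathbb{Z}$-module generated by the $k$-dimensional elementary cubes contained in $X$, with the standard cubical boundary operator; $H_k(X)$ is its homology, and for bounded $X$, $\beta_k(X)$ is the rank of the free part of $H_k(X)$. Random model: $\Omega=[0,1]^{\mathcal{K}^d}$ with product topology and Borel $\sigma$-field; $\omega=(\omega_Q)_{Q\in\mathcal{K}^d}$. Translations $\tau_x\omega=(\omega_{-x+Q})_Q$, $x\in\mathbb{Z}^d$; stationarity means $P\circ\tau_x^{-1}=P$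 for all $x$, ergodicity means translation-invariant events have probability $0$ or $1$. For $t\in[0,1]$, $X(t)=\bigcup\{Q\in\mathcal{K}^d:\omega_Q\le t\}$, $\Lambda_n=[-n,n]^d$, $X^n(t)=X(t)\cap\Lambda_n$, $\beta_q^n(t)=\beta_q(X^n(t))$, $|\Lambda_n|=(2n)^d$ its Lebesgue measure. *)

theory Defs
  imports "HOL-Probability.Probability"
begin

text \<open>An elementary interval is encoded as a pair (l, b): b = True means the
nondegenerate interval [l, l+1], b = False the degenerate interval [l].
An elementary cube in R^d is a list of d elementary intervals; points of R^d
are real lists of length d.\<close>

type_synonym eint = "int \<times> bool"
type_synonym ecube = "eint list"

definition eint_set :: "eint \<Rightarrow> real set" where
  "eint_set I = (if snd I then {real_of_int (fst I) .. real_of_int (fst I) + 1}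
                 else {real_of_int (fst I)})"

definition elem_cubes :: "nat \<Rightarrow> ecube set" where
  "elem_cubes d = {Q. length Q = d}"

definition cube_set :: "ecube \<Rightarrow> real list set" where
  "cube_set Q = {x. length x = length Q \<and> (\<forall>i<length Q. x ! i \<in> eint_set (Q ! i))}"

definition cube_dim :: "ecube \<Rightarrow> nat" where
  "cube_dim Q = length (filter snd Q)"

definition cubes_in :: "nat \<Rightarrow> real list set \<Rightarrow> nat \<Rightarrow> ecube set" where
  "cubes_in d X k = {Q \<in> elem_cubes d. cube_dim Q = k \<and> cube_set Q \<subseteq> X}"

text \<open>Coefficient of P in the standard cubical boundary of Q:
 boundary (I_1 x ... x I_d) = sum over nondegenerate I_j = [l,l+1] of
 (-1)^(number of nondegenerate factors before j) ( Q[I_j := [l+1]] - Q[I_j := [l]] ).\<close>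
definition incidence :: "ecube \<Rightarrow> ecube \<Rightarrow> int" where
  "incidence Q P = (\<Sum>j<length Q.
      if snd (Q ! j) then
        (-1) ^ length (filter snd (take j Q)) *
        ((if P = Q[j := (fst (Q ! j) + 1, False)] then 1 else 0)
         - (if P = Q[j := (fst (Q ! j), False)] then 1 else 0))
      else 0)"

type_synonym chain = "ecube \<Rightarrow> int"

definition chains :: "nat \<Rightarrow> real list set \<Rightarrow> nat \<Rightarrow> chain set" where
  "chains d X k = {c. finite {Q. c Q \<noteq> 0} \<and> (\<forall>Q. c Q \<noteq> 0 \<longrightarrow> Q \<in> cubes_in d X k)}"

definition bdry :: "chain \<Rightarrow> chain" where
  "bdry c = (\<lambda>P. \<Sum>Q\<in>{Q. c Q \<noteq> 0}. c Q * incidence Q P)"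

definition cycles :: "nat \<Rightarrow> real list set \<Rightarrow> nat \<Rightarrow> chain set" where
  "cycles d X k = {c \<in> chains d X k. bdry c = (\<lambda>_. 0)}"

definition boundaries :: "nat \<Rightarrow> real list set \<Rightarrow> nat \<Rightarrow> chain set" where
  "boundaries d X k = bdry ` chains d X (Suc k)"

text \<open>Betti number: rank of the abelian group H_k = Z_k / B_k, i.e. the maximal
number of cycles that are Z-linearly independent modulo boundaries
(= rank of the free part of H_k for bounded X).\<close>
definition betti :: "nat \<Rightarrow> real list set \<Rightarrow> nat \<Rightarrow> nat" where
  "betti d X k = (GREATEST m. \<exists>zs. length zs = m \<and> set zs \<subseteq> cycles d X k \<and>
     (\<forall>a :: nat \<Rightarrow> int. (\<lambda>Q. \<Sum>i<m. a i * (zs ! i) Q) \<in> boundaries d X k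
        \<longrightarrow> (\<forall>i<m. a i = 0)))"

definition Omega :: "nat \<Rightarrow> (ecube \<Rightarrow> real) measure" where
  "Omega d = PiM (elem_cubes d) (\<lambda>_. restrict_space borel {0..1::real})"

definition shift_cube :: "int list \<Rightarrow> ecube \<Rightarrow> ecube" where
  "shift_cube x Q = map (\<lambda>(I, v). (fst I + v, snd I)) (zip Q x)"

definition tau :: "nat \<Rightarrow> int list \<Rightarrow> (ecube \<Rightarrow> real) \<Rightarrow> (ecube \<Rightarrow> real)" where
  "tau d x \<omega> = (\<lambda>Q. if Q \<in> elem_cubes d then \<omega> (shift_cube (map uminus x) Q) else undefined)"

definition stationary :: "nat \<Rightarrow> (ecube \<Rightarrow> real) measure \<Rightarrow> bool" where
  "stationary d P \<longleftrightarrow> (\<forall>x. length x = d \<longrightarrow>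
      (\<forall>A\<in>sets P. emeasure P (tau d x -` A \<inter> space P) = emeasure P A))"

definition ergodic :: "nat \<Rightarrow> (ecube \<Rightarrow> real) measure \<Rightarrow> bool" where
  "ergodic d P \<longleftrightarrow> (\<forall>A\<in>sets P. (\<forall>x. length x = d \<longrightarrow> tau d x -` A \<inter> space P = A)
      \<longrightarrow> measure P A = 0 \<or> measure P A = 1)"

definition Xt :: "nat \<Rightarrow> (ecube \<Rightarrow> real) \<Rightarrow> real \<Rightarrow> real list set" where
  "Xt d \<omega> t = \<Union> {cube_set Q | Q. Q \<in> elem_cubes d \<and> \<omega> Q \<le> t}"

definition Lambda :: "nat \<Rightarrow> nat \<Rightarrow> real list set" where
  "Lambda d n = {x. length x = d \<and> (\<forall>i<d. \<bar>x ! i\<bar> \<le> real n)}"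

definition Xn :: "nat \<Rightarrow> (ecube \<Rightarrow> real) \<Rightarrow> nat \<Rightarrow> real \<Rightarrow> real list set" where
  "Xn d \<omega> n t = Xt d \<omega> t \<inter> Lambda d n"

definition betti_n :: "nat \<Rightarrow> nat \<Rightarrow> (ecube \<Rightarrow> real) \<Rightarrow> nat \<Rightarrow> real \<Rightarrow> real" where
  "betti_n d q \<omega> n t = real (betti d (Xn d \<omega> n t) q)"

definition vol_Lambda :: "nat \<Rightarrow> nat \<Rightarrow> real" where
  "vol_Lambda d n = (2 * real n) ^ d"

end

theory Submission
  imports Defs "HOL-Library.Function_Algebras" "HOL-Real_Asymp.Real_Asymp"
begin

text \<open>Adding cubes to a finite cubical complex changes a Betti number by at most the number of cubes
added: a new cube of dimension \<open>k\<close> relaxes one linear condition on the \<open>k\<close>-cycles and adds one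
generator to the \<open>(k - 1)\<close>-boundaries. So for \<open>s \<le> t\<close> the difference of the Betti numbers at
levels \<open>s\<close> and \<open>t\<close> is bounded by a constant times the number of cubes \<open>R\<close> near the window with
\<open>s < \<omega> R \<le> t\<close>. This count is an ergodic sum. A Vitali covering argument gives a weak-type
maximal inequality for such sums; since the upper limit of the averages is invariant under
translations, ergodicity turns the inequality into the almost sure bound \<open>limsup \<le> 2^d E\<close>, a
constant factor short of the ergodic theorem but sufficient here. As the marginal distribution
functions are continuous, \<open>[0,1]\<close> is covered by finitely many intervals on which all these bounds are
small, and uniform convergence follows from convergence at the finitely many endpoints.\<close>

section \<open>Rank modulo a submodule\<close>

locale domain_module = module scale
  for scale :: "'a::idom \<Rightarrow> 'b::ab_group_add \<Rightarrow> 'b" (infixr "*\<^sub>m" 75)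
begin

definition independent_mod :: "'b set \<Rightarrow> 'i set \<Rightarrow> ('i \<Rightarrow> 'b) \<Rightarrow> bool" where
  "independent_mod B I z \<longleftrightarrow> (\<forall>a. (\<Sum>i\<in>I. a i *\<^sub>m z i) \<in> B \<longrightarrow> (\<forall>i\<in>I. a i = 0))"

definition rank_mod_at_least :: "'b set \<Rightarrow> 'b set \<Rightarrow> nat \<Rightarrow> bool" where
  "rank_mod_at_least Z B m \<longleftrightarrow> (\<exists>z. z ` {..<m} \<subseteq> Z \<and> independent_mod B {..<m} z)"

lemma independent_modI:
  assumes "\<And>a i. (\<Sum>i\<in>I. a i *\<^sub>m z i) \<in> B \<Longrightarrow> i \<in> I \<Longrightarrow> a i = 0"
  shows "independent_mod B I z"
  using assms unfolding independent_mod_def by blast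

lemma independent_modD:
  assumes "independent_mod B I z" "(\<Sum>i\<in>I. a i *\<^sub>m z i) \<in> B" "i \<in> I"
  shows "a i = 0"
  using assms unfolding independent_mod_def by blast

lemma independent_mod_antimono:
  "independent_mod B I z \<Longrightarrow> B' \<subseteq> B \<Longrightarrow> independent_mod B' I z"
  unfolding independent_mod_def by blast

lemma independent_mod_reindex:
  assumes ind: "independent_mod B I z" and "finite I" and h: "inj_on h J" "h ` J \<subseteq> I"
  shows "independent_mod B J (z \<circ> h)"
proof (rule independent_modI)
  fix a j assume a: "(\<Sum>j\<in>J. a j *\<^sub>m (z \<circ> h) j) \<in> B" and j: "j \<in> J"
  define a' where "a' i = (if i \<in> h ` J then a (the_inv_into J h i) else 0)" for i
  have a'_h: "a' (h j) = a j" if "j \<in> J" for j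
    using that h(1) by (simp add: a'_def the_inv_into_f_f)
  have "(\<Sum>i\<in>I. a' i *\<^sub>m z i) = (\<Sum>i\<in>h ` J. a' i *\<^sub>m z i)"
    using \<open>finite I\<close> h(2) by (intro sum.mono_neutral_right) (auto simp: a'_def)
  also have "\<dots> = (\<Sum>j\<in>J. a j *\<^sub>m (z \<circ> h) j)"
    using h(1) by (simp add: sum.reindex a'_h)
  finally have "(\<Sum>i\<in>I. a' i *\<^sub>m z i) \<in> B" using a by simp
  then have "a' (h j) = 0" by (rule independent_modD[OF ind]) (use j h(2) in blast)
  then show "a j = 0" using a'_h[OF j] by simp
qed

lemma rank_mod_at_leastI:
  assumes "finite I" "m \<le> card I" "z ` I \<subseteq> Z" "independent_mod B I z"
  shows "rank_mod_at_least Z B m"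
proof -
  obtain h where h: "h ` {..<m} \<subseteq> I" "inj_on h {..<m}"
    using card_le_inj[of "{..<m}" I] assms(1,2) by auto
  have "independent_mod B {..<m} (z \<circ> h)"
    using assms(4,1) h(2,1) by (rule independent_mod_reindex)
  moreover have "(z \<circ> h) ` {..<m} \<subseteq> Z" using h(1) assms(3) by fastforce
  ultimately show ?thesis unfolding rank_mod_at_least_def by blast
qed

lemma rank_mod_at_leastE:
  assumes "rank_mod_at_least Z B m"
  obtains z where "z ` {..<m} \<subseteq> Z" "independent_mod B {..<m} z"
  using assms unfolding rank_mod_at_least_def by blast

lemma rank_mod_at_least_0: "rank_mod_at_least Z B 0"
  by (simp add: rank_mod_at_least_def independent_mod_def)

lemma rank_mod_at_least_mono:
  assumes "rank_mod_at_least Z B m" "Z \<subseteq> Z'" "B' \<subseteq> B" "k \<le> m"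
  shows "rank_mod_at_least Z' B' k"
proof -
  obtain z where z: "z ` {..<m} \<subseteq> Z" "independent_mod B {..<m} z"
    using assms(1) by (rule rank_mod_at_leastE)
  show ?thesis
  proof (rule rank_mod_at_leastI)
    show "independent_mod B' {..<m} z" using z(2) assms(3) by (rule independent_mod_antimono)
    show "z ` {..<m} \<subseteq> Z'" using z(1) assms(2) by auto
  qed (use assms(4) in auto)
qed

lemma rank_mod_at_least_singleton_0:
  assumes "rank_mod_at_least {0} B m" "0 \<in> B"
  shows "m = 0"
proof -
  obtain z where z: "z ` {..<m} \<subseteq> {0}" "independent_mod B {..<m} z"
    using assms(1) by (rule rank_mod_at_leastE)
  have "(\<Sum>i<m. 1 *\<^sub>m z i) = 0" using z(1) by (intro sum.neutral) auto
  then have "(\<Sum>i<m. 1 *\<^sub>m z i) \<in> B" using assms(2) by simp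
  then have "i \<notin> {..<m}" for i using independent_modD[OF z(2), of "\<lambda>_. 1" i] by auto
  then show "m = 0" by auto
qed

lemma independent_mod_eliminate:
  assumes ind: "independent_mod B I z" and "finite I" and j: "j \<in> I" "c j \<noteq> 0"
  shows "independent_mod B (I - {j}) (\<lambda>i. c j *\<^sub>m z i - c i *\<^sub>m z j)"
proof (rule independent_modI)
  fix a i
  assume a: "(\<Sum>i\<in>I - {j}. a i *\<^sub>m (c j *\<^sub>m z i - c i *\<^sub>m z j)) \<in> B" and i: "i \<in> I - {j}"
  define b where "b = (\<lambda>i. a i * c j)(j := - (\<Sum>i\<in>I - {j}. a i * c i))"
  have "(\<Sum>i\<in>I. b i *\<^sub>m z i) = b j *\<^sub>m z j + (\<Sum>i\<in>I - {j}. b i *\<^sub>m z i)"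
    using \<open>finite I\<close> j(1) by (rule sum.remove)
  also have "\<dots> = (\<Sum>i\<in>I - {j}. (a i * c j) *\<^sub>m z i) - (\<Sum>i\<in>I - {j}. (a i * c i) *\<^sub>m z j)"
    by (simp add: b_def scale_sum_left)
  also have "\<dots> = (\<Sum>i\<in>I - {j}. a i *\<^sub>m (c j *\<^sub>m z i - c i *\<^sub>m z j))"
    unfolding scale_right_diff_distrib sum_subtractf scale_scale ..
  finally have "(\<Sum>i\<in>I. b i *\<^sub>m z i) \<in> B" using a by simp
  then have "b i = 0" by (rule independent_modD[OF ind]) (use i in blast)
  then show "a i = 0" using i j(2) by (simp add: b_def)
qed

lemma rank_mod_at_least_kernel:
  assumes f: "module_hom scale (*) f" and "subspace Z" and rank: "rank_mod_at_least Z B (Suc m)"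
  shows "rank_mod_at_least (Z \<inter> {z. f z = 0}) B m"
proof -
  interpret f: module_hom scale "(*)" f by fact
  let ?I = "{..<Suc m}"
  obtain z where z: "z ` ?I \<subseteq> Z" "independent_mod B ?I z"
    using rank by (rule rank_mod_at_leastE)
  show ?thesis
  proof (cases "\<forall>i\<in>?I. f (z i) = 0")
    case True
    then show ?thesis using z by (intro rank_mod_at_leastI[of ?I _ z]) auto
  next
    case False
    then obtain j where j: "j \<in> ?I" "f (z j) \<noteq> 0" by blast
    let ?w = "\<lambda>i. f (z j) *\<^sub>m z i - f (z i) *\<^sub>m z j"
    show ?thesis
    proof (rule rank_mod_at_leastI[of "?I - {j}" _ ?w])
      show "?w ` (?I - {j}) \<subseteq> Z \<inter> {z. f z = 0}"
        using z(1) j \<open>subspace Z\<close>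
        by (auto simp: f.diff f.scale intro!: subspace_diff subspace_scale)
      show "independent_mod B (?I - {j}) ?w"
        using z(2) j by (intro independent_mod_eliminate) auto
    qed (use j in auto)
  qed
qed

lemma mem_span_insert_subspace:
  assumes "subspace B"
  shows "x \<in> span (insert b B) \<longleftrightarrow> (\<exists>k. x - k *\<^sub>m b \<in> B)"
  using assms by (metis span_breakdown_eq span_eq_iff)

text \<open>Eliminating \<open>b\<close> between the given relation and a hypothetical new one leaves a relation
modulo \<open>B\<close>.\<close>
lemma independent_mod_span_insert:
  assumes B: "subspace B" and ind: "independent_mod B I z" and "finite I"
    and j: "j \<in> I" "a j \<noteq> 0" and a: "(\<Sum>i\<in>I. a i *\<^sub>m z i) \<in> span (insert b B)"
  shows "independent_mod (span (insert b B)) (I - {j}) z"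
proof (rule independent_modI)
  fix c i assume "(\<Sum>i\<in>I - {j}. c i *\<^sub>m z i) \<in> span (insert b B)" and i: "i \<in> I - {j}"
  then obtain l where l: "(\<Sum>i\<in>I - {j}. c i *\<^sub>m z i) - l *\<^sub>m b \<in> B"
    unfolding mem_span_insert_subspace[OF B] by blast
  obtain k where k: "(\<Sum>i\<in>I. a i *\<^sub>m z i) - k *\<^sub>m b \<in> B"
    using a unfolding mem_span_insert_subspace[OF B] by blast
  have "k \<noteq> 0" using k j independent_modD[OF ind, of a j] by auto
  define c' where "c' = c(j := 0)"
  have c': "(\<Sum>i\<in>I. c' i *\<^sub>m z i) = (\<Sum>i\<in>I - {j}. c i *\<^sub>m z i)"
    using \<open>finite I\<close> j(1) by (subst sum.remove[of _ j]) (auto simp: c'_def)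
  have "(\<Sum>i\<in>I. (k * c' i - l * a i) *\<^sub>m z i)
      = k *\<^sub>m ((\<Sum>i\<in>I. c' i *\<^sub>m z i) - l *\<^sub>m b) - l *\<^sub>m ((\<Sum>i\<in>I. a i *\<^sub>m z i) - k *\<^sub>m b)"
    by (simp add: scale_left_diff_distrib sum_subtractf scale_sum_right
        scale_right_diff_distrib mult.commute)
  also have "\<dots> \<in> B"
    unfolding c' by (intro subspace_diff[OF B] subspace_scale[OF B] k l)
  finally have coeff: "k * c' i - l * a i = 0" if "i \<in> I" for i
    using independent_modD[OF ind, of "\<lambda>i. k * c' i - l * a i"] that by blast
  have "l = 0" using coeff[OF j(1)] j(2) by (simp add: c'_def)
  then show "c i = 0" using coeff[of i] i \<open>k \<noteq> 0\<close> by (simp add: c'_def)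
qed

lemma rank_mod_at_least_span_insert:
  assumes "subspace B" and rank: "rank_mod_at_least Z B (Suc m)"
  shows "rank_mod_at_least Z (span (insert b B)) m"
proof -
  let ?I = "{..<Suc m}" and ?B = "span (insert b B)"
  obtain z where z: "z ` ?I \<subseteq> Z" "independent_mod B ?I z"
    using rank by (rule rank_mod_at_leastE)
  show ?thesis
  proof (cases "independent_mod ?B ?I z")
    case True
    then show ?thesis using z(1) by (intro rank_mod_at_leastI[of ?I _ z]) auto
  next
    case False
    then obtain a j where j: "j \<in> ?I" "a j \<noteq> 0" and a: "(\<Sum>i\<in>?I. a i *\<^sub>m z i) \<in> ?B"
      unfolding independent_mod_def by blast
    have "independent_mod ?B (?I - {j}) z"
      using assms(1) z(2) finite_lessThan j a by (rule independent_mod_span_insert)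
    then show ?thesis using z(1) j(1) by (intro rank_mod_at_leastI[of "?I - {j}" _ z]) auto
  qed
qed

lemma rank_mod_at_least_common_kernel:
  assumes "finite D" and f: "\<And>r. r \<in> D \<Longrightarrow> module_hom scale (*) (f r)"
    and "subspace Z" and "rank_mod_at_least Z B m"
  shows "rank_mod_at_least (Z \<inter> {z. \<forall>r\<in>D. f r z = 0}) B (m - card D)"
  using assms
proof (induction D arbitrary: Z m rule: finite_induct)
  case (insert r D)
  interpret f: module_hom scale "(*)" "f r" using insert.prems(1) by simp
  let ?K = "Z \<inter> {z. f r z = 0}"
  have "rank_mod_at_least ?K B (m - 1)"
  proof (cases m)
    case 0
    then show ?thesis by (simp add: rank_mod_at_least_0)
  next
    case (Suc k)
    then show ?thesis
      using rank_mod_at_least_kernel[OF f.module_hom_axioms insert.prems(2)] insert.prems(3)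
      by simp
  qed
  moreover have "subspace ?K" using insert.prems(2) f.subspace_kernel by (rule subspace_inter)
  ultimately have "rank_mod_at_least (?K \<inter> {z. \<forall>r\<in>D. f r z = 0}) B (m - 1 - card D)"
    using insert.prems(1) by (intro insert.IH) auto
  moreover have "?K \<inter> {z. \<forall>r\<in>D. f r z = 0} = Z \<inter> {z. \<forall>r\<in>insert r D. f r z = 0}" by blast
  ultimately show ?case using insert.hyps by simp
qed simp

lemma rank_mod_at_least_span_Un:
  assumes "finite D" "subspace B" "rank_mod_at_least Z B m"
  shows "rank_mod_at_least Z (span (B \<union> D)) (m - card D)"
  using assms
proof (induction D rule: finite_induct)
  case empty
  then show ?case by (metis Un_empty_right card.empty diff_zero span_eq_iff)
next
  case (insert b D)
  let ?S = "span (B \<union> D)"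
  have IH: "rank_mod_at_least Z ?S (m - card D)" using insert.IH insert.prems by blast
  have "rank_mod_at_least Z (span (insert b ?S)) (m - card D - 1)"
  proof (cases "m - card D")
    case 0
    then show ?thesis by (simp add: rank_mod_at_least_0)
  next
    case (Suc k)
    then show ?thesis
      using rank_mod_at_least_span_insert[OF subspace_span, of Z "B \<union> D" k b] IH by simp
  qed
  moreover have "span (B \<union> insert b D) \<subseteq> span (insert b ?S)"
    by (intro span_mono) (use span_superset[of "B \<union> D"] in blast)
  ultimately show ?case
    using insert.hyps by (auto intro: rank_mod_at_least_mono)
qed

end

section \<open>Betti numbers under the addition of cubes\<close>

definition chain_scale :: "int \<Rightarrow> chain \<Rightarrow> chain" (infixr "*\<^sub>c" 75) where
  "k *\<^sub>c c = (\<lambda>Q. k * c Q)"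

lemma chain_scale_apply [simp]: "(k *\<^sub>c c) Q = k * c Q"
  by (simp add: chain_scale_def)

interpretation chain: domain_module chain_scale
  by standard (simp_all add: fun_eq_iff algebra_simps)

lemma sum_fun_apply:
  fixes f :: "'i \<Rightarrow> 'a \<Rightarrow> 'b::comm_monoid_add"
  shows "(\<Sum>i\<in>I. f i) x = (\<Sum>i\<in>I. f i x)"
  by (induction I rule: infinite_finite_induct) auto

lemma module_hom_chain_coefficient: "module_hom chain_scale (*) (\<lambda>c. c Q)"
  by standard (simp_all add: algebra_simps)

lemma bdry_eq_sum:
  assumes "finite S" "{Q. c Q \<noteq> 0} \<subseteq> S"
  shows "bdry c = (\<Sum>Q\<in>S. c Q *\<^sub>c incidence Q)"
  unfolding bdry_def fun_eq_iff sum_fun_apply chain_scale_apply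
  using assms by (auto intro: sum.mono_neutral_left)

lemma bdry_add:
  assumes "finite {Q. c Q \<noteq> 0}" "finite {Q. c' Q \<noteq> 0}"
  shows "bdry (c + c') = bdry c + bdry c'"
proof -
  let ?S = "{Q. c Q \<noteq> 0} \<union> {Q. c' Q \<noteq> 0}"
  have "bdry (c + c') = (\<Sum>Q\<in>?S. (c + c') Q *\<^sub>c incidence Q)"
    using assms by (intro bdry_eq_sum) auto
  also have "\<dots> = (\<Sum>Q\<in>?S. c Q *\<^sub>c incidence Q) + (\<Sum>Q\<in>?S. c' Q *\<^sub>c incidence Q)"
    by (simp add: chain.scale_left_distrib sum.distrib)
  finally show ?thesis using assms by (simp add: bdry_eq_sum[of ?S])
qed

lemma bdry_scale: "bdry (k *\<^sub>c c) = k *\<^sub>c bdry c"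
proof (cases "k = 0")
  case False
  then show ?thesis by (simp add: bdry_def fun_eq_iff sum_distrib_left mult.assoc)
qed (simp add: bdry_def fun_eq_iff)

lemma bdry_single: "bdry (\<lambda>P. if P = Q then 1 else 0) = incidence Q"
  by (subst bdry_eq_sum[of "{Q}"]) auto

lemma chains_eq: "chains d X k = {c. finite {Q. c Q \<noteq> 0} \<and> {Q. c Q \<noteq> 0} \<subseteq> cubes_in d X k}"
  by (auto simp: chains_def)

lemma subspace_chains: "chain.subspace (chains d X k)"
proof (rule chain.subspaceI)
  show "0 \<in> chains d X k" by (simp add: chains_def)
  show "c + c' \<in> chains d X k" if "c \<in> chains d X k" "c' \<in> chains d X k" for c c'
  proof -
    have "{Q. (c + c') Q \<noteq> 0} \<subseteq> {Q. c Q \<noteq> 0} \<union> {Q. c' Q \<noteq> 0}" by auto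
    then show ?thesis using that unfolding chains_eq by (auto intro: finite_subset)
  qed
  show "a *\<^sub>c c \<in> chains d X k" if "c \<in> chains d X k" for a c
  proof -
    have "{Q. (a *\<^sub>c c) Q \<noteq> 0} \<subseteq> {Q. c Q \<noteq> 0}" by auto
    then show ?thesis using that unfolding chains_eq by (auto intro: finite_subset)
  qed
qed

lemma finite_support_chains: "c \<in> chains d X k \<Longrightarrow> finite {Q. c Q \<noteq> 0}"
  by (simp add: chains_def)

lemma subspace_cycles: "chain.subspace (cycles d X k)"
proof (rule chain.subspaceI)
  show "0 \<in> cycles d X k"
    using chain.subspace_0[OF subspace_chains] by (auto simp: cycles_def bdry_def)
  show "c + c' \<in> cycles d X k" if "c \<in> cycles d X k" "c' \<in> cycles d X k" for c c'
    using that chain.subspace_add[OF subspace_chains, of c d X k c'] finite_support_chains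
    by (auto simp: cycles_def bdry_add fun_eq_iff)
  show "a *\<^sub>c c \<in> cycles d X k" if "c \<in> cycles d X k" for a c
    using that chain.subspace_scale[OF subspace_chains]
    by (auto simp: cycles_def bdry_scale fun_eq_iff)
qed

lemma boundaries_eq_span: "boundaries d X k = chain.span (incidence ` cubes_in d X (Suc k))"
proof (rule chain.span_unique[symmetric])
  show "incidence ` cubes_in d X (Suc k) \<subseteq> boundaries d X k"
  proof (rule image_subsetI)
    fix Q assume "Q \<in> cubes_in d X (Suc k)"
    then have "(\<lambda>P. if P = Q then 1 else 0) \<in> chains d X (Suc k)" by (simp add: chains_def)
    then show "incidence Q \<in> boundaries d X k"
      unfolding boundaries_def bdry_single[symmetric] by (rule imageI)
  qed
  show "chain.subspace (boundaries d X k)"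
  proof (rule chain.subspaceI)
    show "0 \<in> boundaries d X k"
      using chain.subspace_0[OF subspace_chains]
      by (auto simp: boundaries_def bdry_def fun_eq_iff intro!: image_eqI[of _ _ 0])
    show "b + b' \<in> boundaries d X k" if "b \<in> boundaries d X k" "b' \<in> boundaries d X k" for b b'
      using that chain.subspace_add[OF subspace_chains] finite_support_chains
      unfolding boundaries_def by (auto simp flip: bdry_add)
    show "a *\<^sub>c b \<in> boundaries d X k" if "b \<in> boundaries d X k" for a b
      using that chain.subspace_scale[OF subspace_chains]
      unfolding boundaries_def by (auto simp flip: bdry_scale)
  qed
  show "boundaries d X k \<subseteq> T"
    if "incidence ` cubes_in d X (Suc k) \<subseteq> T" "chain.subspace T" for T
  proof
    fix b assume "b \<in> boundaries d X k"
    then obtain c where c: "c \<in> chains d X (Suc k)" "b = bdry c" unfolding boundaries_def by blast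
    have "b = (\<Sum>Q\<in>{Q. c Q \<noteq> 0}. c Q *\<^sub>c incidence Q)"
      unfolding c(2) using finite_support_chains[OF c(1)] by (rule bdry_eq_sum) simp
    also have "\<dots> \<in> T"
      using that c(1) by (intro chain.subspace_sum chain.subspace_scale) (auto simp: chains_def)
    finally show "b \<in> T" .
  qed
qed

lemma betti_eq_Greatest_rank:
  "betti d X k = (GREATEST m. chain.rank_mod_at_least (cycles d X k) (boundaries d X k) m)"
proof -
  have "(\<exists>zs. length zs = m \<and> set zs \<subseteq> Z \<and>
      (\<forall>a :: nat \<Rightarrow> int. (\<lambda>Q. \<Sum>i<m. a i * (zs ! i) Q) \<in> B \<longrightarrow> (\<forall>i<m. a i = 0)))
    \<longleftrightarrow> chain.rank_mod_at_least Z B m" (is "?lists \<longleftrightarrow> ?families") for Z B m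
  proof -
    have indep: "chain.independent_mod B {..<m} z \<longleftrightarrow>
        (\<forall>a. (\<lambda>Q. \<Sum>i<m. a i * z i Q) \<in> B \<longrightarrow> (\<forall>i<m. a i = 0))" for z
    proof -
      have "(\<Sum>i<m. a i *\<^sub>c z i) = (\<lambda>Q. \<Sum>i<m. a i * z i Q)" for a
        by (simp add: fun_eq_iff sum_fun_apply)
      then show ?thesis unfolding chain.independent_mod_def by (simp add: Ball_def)
    qed
    show ?thesis
    proof
      assume ?lists
      then obtain zs where "length zs = m" "set zs \<subseteq> Z" "chain.independent_mod B {..<m} ((!) zs)"
        unfolding indep by blast
      then show ?families unfolding chain.rank_mod_at_least_def
        by (intro exI[of _ "(!) zs"]) auto
    next
      assume ?families
      then obtain z where z: "z ` {..<m} \<subseteq> Z" "chain.independent_mod B {..<m} z"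
        unfolding chain.rank_mod_at_least_def by blast
      show ?lists
        using z(1) z(2)[unfolded indep] by (intro exI[of _ "map z [0..<m]"]) auto
    qed
  qed
  then show ?thesis unfolding betti_def by simp
qed

lemma cubes_in_mono: "Y \<subseteq> X \<Longrightarrow> cubes_in d Y k \<subseteq> cubes_in d X k"
  by (auto simp: cubes_in_def)

lemma cycles_eq_vanishing:
  assumes "Y \<subseteq> X"
  shows "cycles d Y k = cycles d X k \<inter> {c. \<forall>R\<in>cubes_in d X k - cubes_in d Y k. c R = 0}"
  using cubes_in_mono[OF assms] unfolding cycles_def chains_def by blast

lemma rank_cycles_le_card:
  assumes "finite (cubes_in d X k)"
    and "chain.rank_mod_at_least (cycles d X k) (boundaries d X k) m"
  shows "m \<le> card (cubes_in d X k)"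
proof -
  have "cycles d X k \<inter> {c. \<forall>R\<in>cubes_in d X k. c R = 0} \<subseteq> {0}"
    by (force simp: cycles_def chains_def fun_eq_iff)
  with chain.rank_mod_at_least_common_kernel[OF assms(1) module_hom_chain_coefficient
      subspace_cycles assms(2)]
  have "chain.rank_mod_at_least {0} (boundaries d X k) (m - card (cubes_in d X k))"
    by (rule chain.rank_mod_at_least_mono) auto
  then have "m - card (cubes_in d X k) = 0"
    by (rule chain.rank_mod_at_least_singleton_0) (simp add: boundaries_eq_span chain.span_zero)
  then show ?thesis by simp
qed

lemma rank_mod_at_least_iff_le_betti:
  assumes "finite (cubes_in d X k)"
  shows "chain.rank_mod_at_least (cycles d X k) (boundaries d X k) m \<longleftrightarrow> m \<le> betti d X k"
    (is "?rank m \<longleftrightarrow> _")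
proof
  assume "?rank m"
  then show "m \<le> betti d X k"
    unfolding betti_eq_Greatest_rank
    by (rule Greatest_le_nat) (rule rank_cycles_le_card[OF assms])
next
  have "?rank (betti d X k)"
    unfolding betti_eq_Greatest_rank
    by (rule GreatestI_nat) (rule chain.rank_mod_at_least_0, rule rank_cycles_le_card[OF assms])
  then show "?rank m" if "m \<le> betti d X k"
    by (rule chain.rank_mod_at_least_mono) (use that in auto)
qed

lemma betti_superset_le:
  assumes "Y \<subseteq> X" "finite (cubes_in d X k)"
  shows "betti d X k \<le> betti d Y k + card (cubes_in d X k - cubes_in d Y k)"
proof -
  let ?D = "cubes_in d X k - cubes_in d Y k"
  note sub = cubes_in_mono[OF assms(1)]
  have "chain.rank_mod_at_least (cycles d X k) (boundaries d X k) (betti d X k)"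
    by (simp add: rank_mod_at_least_iff_le_betti assms(2))
  then have "chain.rank_mod_at_least (cycles d X k) (boundaries d Y k) (betti d X k)"
    by (rule chain.rank_mod_at_least_mono)
      (simp_all add: boundaries_eq_span chain.span_mono image_mono sub)
  then have "chain.rank_mod_at_least (cycles d Y k) (boundaries d Y k) (betti d X k - card ?D)"
    unfolding cycles_eq_vanishing[OF assms(1)]
    using assms(2) module_hom_chain_coefficient subspace_cycles
    by (intro chain.rank_mod_at_least_common_kernel) auto
  then have "betti d X k - card ?D \<le> betti d Y k"
    using finite_subset[OF sub assms(2)] by (simp add: rank_mod_at_least_iff_le_betti)
  then show ?thesis by simp
qed

lemma betti_subset_le:
  assumes "Y \<subseteq> X" "finite (cubes_in d X k)" "finite (cubes_in d X (Suc k))"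
  shows "betti d Y k \<le> betti d X k + card (cubes_in d X (Suc k) - cubes_in d Y (Suc k))"
proof -
  let ?D = "cubes_in d X (Suc k) - cubes_in d Y (Suc k)"
  note sub = cubes_in_mono[OF assms(1)]
  have "chain.rank_mod_at_least (cycles d Y k) (boundaries d Y k) (betti d Y k)"
    using finite_subset[OF sub assms(2)] by (simp add: rank_mod_at_least_iff_le_betti)
  then have "chain.rank_mod_at_least (cycles d X k) (boundaries d Y k) (betti d Y k)"
    by (rule chain.rank_mod_at_least_mono) (auto simp: cycles_eq_vanishing[OF assms(1)])
  then have "chain.rank_mod_at_least (cycles d X k)
      (chain.span (boundaries d Y k \<union> incidence ` ?D)) (betti d Y k - card (incidence ` ?D))"
    using assms(3) by (intro chain.rank_mod_at_least_span_Un) (auto simp: boundaries_eq_span)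
  then have "chain.rank_mod_at_least (cycles d X k) (boundaries d X k) (betti d Y k - card ?D)"
  proof (rule chain.rank_mod_at_least_mono)
    show "boundaries d X k \<subseteq> chain.span (boundaries d Y k \<union> incidence ` ?D)"
      unfolding boundaries_eq_span using chain.span_superset[of "incidence ` cubes_in d Y (Suc k)"]
      by (intro chain.span_mono) blast
    show "betti d Y k - card ?D \<le> betti d Y k - card (incidence ` ?D)"
      using assms(3) by (intro diff_le_mono2 card_image_le) simp
  qed simp
  then have "betti d Y k - card ?D \<le> betti d X k"
    using assms(2) by (simp add: rank_mod_at_least_iff_le_betti)
  then show ?thesis by simp
qed

section \<open>A covering lemma for lattice boxes\<close>

lemma greedy_disjoint_subfamily:
  fixes S :: "'i \<Rightarrow> 'a set" and r :: "'i \<Rightarrow> 'r::linorder"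
  assumes "finite G" and "\<And>x. x \<in> G \<Longrightarrow> S x \<noteq> {}"
  shows "\<exists>H\<subseteq>G. disjoint_family_on S H \<and> (\<forall>y\<in>G. \<exists>x\<in>H. S y \<inter> S x \<noteq> {} \<and> r y \<le> r x)"
  using assms
proof (induction G rule: finite_psubset_induct)
  case (psubset G)
  show ?case
  proof (cases "G = {}")
    case False
    then have "Max (r ` G) \<in> r ` G" using psubset.hyps by (intro Max_in) auto
    then obtain x where x: "x \<in> G" "r x = Max (r ` G)" by auto
    have largest: "r y \<le> r x" if "y \<in> G" for y using that psubset.hyps x(2) by simp
    define G' where "G' = {y \<in> G. S y \<inter> S x = {}}"
    have smaller: "G' \<subset> G" using x(1) psubset.prems unfolding G'_def by blast
    have "S y \<noteq> {}" if "y \<in> G'" for y using that psubset.prems unfolding G'_def by blast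
    from psubset.IH[OF smaller this] obtain H where H: "H \<subseteq> G'" "disjoint_family_on S H"
      "\<forall>y\<in>G'. \<exists>x\<in>H. S y \<inter> S x \<noteq> {} \<and> r y \<le> r x" by blast
    show ?thesis
    proof (intro exI[of _ "insert x H"] conjI ballI)
      show "insert x H \<subseteq> G" using H(1) x(1) unfolding G'_def by blast
      show "disjoint_family_on S (insert x H)"
        using H(1,2) unfolding disjoint_family_on_def G'_def by blast
      show "\<exists>x'\<in>insert x H. S y \<inter> S x' \<noteq> {} \<and> r y \<le> r x'" if "y \<in> G" for y
        using H(3) largest[OF that] that unfolding G'_def by blast
    qed
  qed (simp add: disjoint_family_on_def)
qed

lemma in_listset_iff:
  "xs \<in> listset As \<longleftrightarrow> length xs = length As \<and> (\<forall>i<length As. xs ! i \<in> As ! i)"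
proof (induction As arbitrary: xs)
  case (Cons A As)
  then show ?case by (cases xs) (auto simp: set_Cons_def nth_Cons' less_Suc_eq_0_disj)
qed simp

lemma set_Cons_eq_image: "set_Cons A Xs = (\<lambda>(x, xs). x # xs) ` (A \<times> Xs)"
  by (auto simp: set_Cons_def)

lemma finite_listset: "(\<And>A. A \<in> set As \<Longrightarrow> finite A) \<Longrightarrow> finite (listset As)"
  by (induction As) (auto simp: set_Cons_eq_image)

lemma card_listset: "card (listset As) = (\<Prod>A\<leftarrow>As. card A)"
proof (induction As)
  case (Cons A As)
  have "inj_on (\<lambda>(x, xs). x # xs) (A \<times> listset As)" by (auto simp: inj_on_def)
  then show ?case using Cons by (simp add: set_Cons_eq_image card_image card_cartesian_product)
qed simp

definition lattice_box :: "int list \<Rightarrow> nat \<Rightarrow> int list set" where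
  "lattice_box x n = listset (map (\<lambda>a. {a - int n..a + int n}) x)"

lemma finite_lattice_box [simp]: "finite (lattice_box x n)"
  unfolding lattice_box_def by (rule finite_listset) auto

lemma card_lattice_box: "card (lattice_box x n) = (2 * n + 1) ^ length x"
  unfolding lattice_box_def card_listset
  by (induction x) (simp_all add: nat_add_distrib nat_mult_distrib)

lemma in_lattice_box_iff:
  "y \<in> lattice_box x n \<longleftrightarrow> length y = length x \<and> (\<forall>i<length x. \<bar>y ! i - x ! i\<bar> \<le> int n)"
  unfolding lattice_box_def in_listset_iff by (auto simp: abs_le_iff algebra_simps)

lemma center_in_lattice_box: "x \<in> lattice_box x n"
  by (simp add: in_lattice_box_iff)

lemma lattice_box_nonempty [simp]: "lattice_box x n \<noteq> {}"
  using center_in_lattice_box by blast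

lemma lattice_box_sym: "y \<in> lattice_box x n \<Longrightarrow> x \<in> lattice_box y n"
  by (auto simp: in_lattice_box_iff abs_minus_commute)

lemma lattice_box_trans:
  assumes "y \<in> lattice_box x n" "z \<in> lattice_box y m" "n + m \<le> k"
  shows "z \<in> lattice_box x k"
  unfolding in_lattice_box_iff
proof (intro conjI allI impI)
  fix i assume "i < length x"
  then have "\<bar>y ! i - x ! i\<bar> \<le> int n" "\<bar>z ! i - y ! i\<bar> \<le> int m"
    using assms by (auto simp: in_lattice_box_iff)
  then show "\<bar>z ! i - x ! i\<bar> \<le> int k" using assms(3) by linarith
qed (use assms in \<open>simp add: in_lattice_box_iff\<close>)

lemma card_lattice_box_double:
  "card (lattice_box x (2 * n)) \<le> 2 ^ length x * card (lattice_box x n)"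
  unfolding card_lattice_box power_mult_distrib[symmetric] by (intro power_mono) auto

lemma vitali_lattice_boxes:
  assumes "finite G"
  obtains H where "H \<subseteq> G" "disjoint_family_on (\<lambda>x. lattice_box x (n x)) H"
    "G \<subseteq> (\<Union>x\<in>H. lattice_box x (2 * n x))"
proof -
  let ?S = "\<lambda>x. lattice_box x (n x)"
  have "?S x \<noteq> {}" for x by simp
  from greedy_disjoint_subfamily[where S = ?S and r = n, OF assms this]
  obtain H where H: "H \<subseteq> G" "disjoint_family_on ?S H"
    "\<forall>y\<in>G. \<exists>x\<in>H. ?S y \<inter> ?S x \<noteq> {} \<and> n y \<le> n x" by blast
  have "y \<in> (\<Union>x\<in>H. lattice_box x (2 * n x))" if y: "y \<in> G" for y
  proof -
    obtain x where x: "x \<in> H" "n y \<le> n x" and "?S y \<inter> ?S x \<noteq> {}"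
      using H(3) y by blast
    then obtain z where z: "z \<in> ?S y" "z \<in> ?S x" by blast
    have "y \<in> lattice_box x (2 * n x)"
      using z(2) lattice_box_sym[OF z(1)] by (rule lattice_box_trans) (use x(2) in simp)
    then show ?thesis using x(1) by blast
  qed
  then show thesis using H(1,2) by (intro that) auto
qed

lemma vitali_card_le_sum:
  fixes F :: "int list \<Rightarrow> real"
  assumes "finite G" and len: "\<And>x. x \<in> G \<Longrightarrow> length x = d"
    and F: "\<And>y. 0 \<le> F y" and "0 \<le> c"
    and large: "\<And>x. x \<in> G \<Longrightarrow> c * real (card (lattice_box x (n x))) \<le> (\<Sum>y\<in>lattice_box x (n x). F y)"
  shows "c * real (card G) \<le> 2 ^ d * (\<Sum>y\<in>(\<Union>x\<in>G. lattice_box x (n x)). F y)"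
proof -
  let ?S = "\<lambda>x. lattice_box x (n x)"
  obtain H where H: "H \<subseteq> G" "disjoint_family_on ?S H" "G \<subseteq> (\<Union>x\<in>H. lattice_box x (2 * n x))"
    using \<open>finite G\<close> by (rule vitali_lattice_boxes)
  have "finite H" using H(1) \<open>finite G\<close> by (rule finite_subset)
  have "card G \<le> card (\<Union>x\<in>H. lattice_box x (2 * n x))"
    using H(3) \<open>finite H\<close> by (intro card_mono) auto
  also have "\<dots> \<le> (\<Sum>x\<in>H. card (lattice_box x (2 * n x)))"
    using \<open>finite H\<close> by (rule card_UN_le)
  also have "\<dots> \<le> (\<Sum>x\<in>H. 2 ^ d * card (?S x))"
    using card_lattice_box_double len H(1) by (intro sum_mono) (metis subsetD)
  finally have "real (card G) \<le> real (\<Sum>x\<in>H. 2 ^ d * card (?S x))" by (rule of_nat_mono)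
  then have "c * real (card G) \<le> c * real (\<Sum>x\<in>H. 2 ^ d * card (?S x))"
    using \<open>0 \<le> c\<close> by (rule mult_left_mono)
  also have "\<dots> = 2 ^ d * (\<Sum>x\<in>H. c * real (card (?S x)))"
    by (simp add: sum_distrib_left mult.left_commute)
  also have "(\<Sum>x\<in>H. c * real (card (?S x))) \<le> (\<Sum>x\<in>H. \<Sum>y\<in>?S x. F y)"
    using large H(1) by (intro sum_mono) auto
  also have "\<dots> = (\<Sum>y\<in>(\<Union>x\<in>H. ?S x). F y)"
    using \<open>finite H\<close> H(2)
    by (intro sum.UNION_disjoint[symmetric]) (auto simp: disjoint_family_on_def)
  also have "\<dots> \<le> (\<Sum>y\<in>(\<Union>x\<in>G. ?S x). F y)"
    using H(1) F \<open>finite G\<close> by (intro sum_mono2) auto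
  finally show ?thesis by simp
qed

section \<open>A maximal inequality for lattice actions\<close>

definition lattice_add :: "int list \<Rightarrow> int list \<Rightarrow> int list" where
  "lattice_add x y = map2 (+) x y"

lemma length_lattice_add [simp]: "length (lattice_add x y) = min (length x) (length y)"
  by (simp add: lattice_add_def)

lemma nth_lattice_add [simp]:
  "i < length x \<Longrightarrow> i < length y \<Longrightarrow> lattice_add x y ! i = x ! i + y ! i"
  by (simp add: lattice_add_def)

abbreviation origin :: "nat \<Rightarrow> int list" where
  "origin d \<equiv> replicate d 0"

definition box_ratio :: "nat \<Rightarrow> nat \<Rightarrow> nat \<Rightarrow> real" where
  "box_ratio d r n = card (lattice_box (origin d) (n + r)) / card (lattice_box (origin d) n)"

lemma box_ratio_tendsto_1: "box_ratio d r \<longlonglongrightarrow> 1"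
proof -
  have "(\<lambda>n. ((2 * real (n + r) + 1) / (2 * real n + 1)) ^ d) \<longlonglongrightarrow> 1 ^ d"
    by (intro tendsto_power) real_asymp
  then show ?thesis
    by (simp add: box_ratio_def[abs_def] card_lattice_box power_divide add.commute)
qed

lemma ex_lattice_box_origin: "\<exists>r. x \<in> lattice_box (origin (length x)) r"
proof -
  let ?r = "nat (Max (insert 0 (abs ` set x)))"
  have "\<bar>x ! i\<bar> \<le> int ?r" if "i < length x" for i
    using that by (auto intro!: Max_ge)
  then show ?thesis by (intro exI[of _ ?r]) (simp add: in_lattice_box_iff)
qed

locale lattice_action = prob_space P for P :: "'a measure" +
  fixes d :: nat and T :: "int list \<Rightarrow> 'a \<Rightarrow> 'a"
  assumes measurable_T: "length x = d \<Longrightarrow> T x \<in> measurable P P"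
    and distr_T: "length x = d \<Longrightarrow> distr P P (T x) = P"
    and T_origin: "\<omega> \<in> space P \<Longrightarrow> T (origin d) \<omega> = \<omega>"
    and T_add: "length x = d \<Longrightarrow> length y = d \<Longrightarrow> \<omega> \<in> space P \<Longrightarrow>
      T y (T x \<omega>) = T (lattice_add x y) \<omega>"
begin

definition box_avg :: "('a \<Rightarrow> real) \<Rightarrow> int list \<Rightarrow> nat \<Rightarrow> 'a \<Rightarrow> real" where
  "box_avg f x n \<omega> = (\<Sum>y\<in>lattice_box x n. f (T y \<omega>)) / real (card (lattice_box x n))"

lemma T_space: "length x = d \<Longrightarrow> \<omega> \<in> space P \<Longrightarrow> T x \<omega> \<in> space P"
  using measurable_T measurable_space by metis

lemma length_in_box: "y \<in> lattice_box (origin d) n \<Longrightarrow> length y = d"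
  by (simp add: in_lattice_box_iff)

lemma integrable_T: "length x = d \<Longrightarrow> integrable P f \<Longrightarrow> integrable P (\<lambda>\<omega>. f (T x \<omega>))"
  for f :: "'a \<Rightarrow> real"
  using integrable_distr_eq[OF measurable_T, of x f] distr_T by auto

lemma integral_T:
  fixes f :: "'a \<Rightarrow> real"
  assumes "length x = d" "f \<in> borel_measurable P"
  shows "(\<integral>\<omega>. f (T x \<omega>) \<partial>P) = (\<integral>\<omega>. f \<omega> \<partial>P)"
  using integral_distr[OF measurable_T[OF assms(1)], of f] assms distr_T by simp

lemma integrable_box_avg:
  assumes "integrable P f"
  shows "integrable P (box_avg f (origin d) n)"
  unfolding box_avg_def[abs_def] using assms length_in_box
  by (intro integrable_divide Bochner_Integration.integrable_sum integrable_T) auto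

lemma borel_measurable_box_avg:
  "integrable P f \<Longrightarrow> box_avg f (origin d) n \<in> borel_measurable P"
  using integrable_box_avg by blast

lemma integral_box_avg:
  assumes "integrable P f"
  shows "(\<integral>\<omega>. box_avg f (origin d) n \<omega> \<partial>P) = (\<integral>\<omega>. f \<omega> \<partial>P)"
proof -
  have "(\<integral>\<omega>. (\<Sum>y\<in>lattice_box (origin d) n. f (T y \<omega>)) \<partial>P)
      = (\<Sum>y\<in>lattice_box (origin d) n. \<integral>\<omega>. f (T y \<omega>) \<partial>P)"
    using assms length_in_box by (intro Bochner_Integration.integral_sum integrable_T) auto
  also have "\<dots> = (\<Sum>y\<in>lattice_box (origin d) n. \<integral>\<omega>. f \<omega> \<partial>P)"
    using assms length_in_box by (intro sum.cong refl integral_T) auto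
  finally show ?thesis by (simp add: box_avg_def)
qed

lemma box_avg_T:
  assumes x: "length x = d" and \<omega>: "\<omega> \<in> space P"
  shows "box_avg f (origin d) n (T x \<omega>) = box_avg f x n \<omega>"
proof -
  have "(\<Sum>y\<in>lattice_box (origin d) n. f (T y (T x \<omega>))) = (\<Sum>y\<in>lattice_box x n. f (T y \<omega>))"
  proof (rule sum.reindex_bij_witness[where j = "lattice_add x" and
        i = "\<lambda>y. lattice_add y (map uminus x)"])
    fix y assume y: "y \<in> lattice_box (origin d) n"
    then show "lattice_add (lattice_add x y) (map uminus x) = y"
      "lattice_add x y \<in> lattice_box x n"
      using x by (auto simp: in_lattice_box_iff list_eq_iff_nth_eq)
    show "f (T (lattice_add x y) \<omega>) = f (T y (T x \<omega>))"
      using T_add[OF x _ \<omega>] length_in_box[OF y] by simp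
  next
    fix y assume "y \<in> lattice_box x n"
    then show "lattice_add x (lattice_add y (map uminus x)) = y"
      "lattice_add y (map uminus x) \<in> lattice_box (origin d) n"
      using x by (auto simp: in_lattice_box_iff list_eq_iff_nth_eq)
  qed
  then show ?thesis using x by (simp add: box_avg_def card_lattice_box)
qed

lemma box_avg_le_ratio:
  assumes "\<And>\<omega>. 0 \<le> f \<omega>" "x \<in> lattice_box (origin d) r"
  shows "box_avg f x n \<omega> \<le> box_ratio d r n * box_avg f (origin d) (n + r) \<omega>"
proof -
  have "card (lattice_box x n) = card (lattice_box (origin d) n)"
    using length_in_box[OF assms(2)] by (simp add: card_lattice_box)
  moreover have "lattice_box x n \<subseteq> lattice_box (origin d) (n + r)"
    using lattice_box_trans[OF assms(2)] by (simp add: subsetI)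
  then have "(\<Sum>y\<in>lattice_box x n. f (T y \<omega>)) \<le> (\<Sum>y\<in>lattice_box (origin d) (n + r). f (T y \<omega>))"
    using assms(1) by (intro sum_mono2) auto
  ultimately show ?thesis by (simp add: box_avg_def box_ratio_def divide_right_mono)
qed

lemma maximal_average_le:
  fixes c :: real
  assumes f: "\<And>\<omega>. 0 \<le> f \<omega>" and "0 \<le> c" and \<omega>: "\<omega> \<in> space P"
    and E_def: "E = {\<omega>\<in>space P. \<exists>n\<le>N. c < box_avg f (origin d) n \<omega>}"
  shows "c * box_avg (indicator E) (origin d) K \<omega>
    \<le> 2 ^ d * (box_ratio d N K * box_avg f (origin d) (K + N) \<omega>)"
proof -
  let ?B = "lattice_box (origin d)"
  define G where "G = {x \<in> ?B K. T x \<omega> \<in> E}"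
  have G: "length x = d" "x \<in> ?B K" if "x \<in> G" for x
    using that length_in_box by (auto simp: G_def)
  have "finite G" by (simp add: G_def)
  have "\<forall>x\<in>G. \<exists>n\<le>N. c < box_avg f x n \<omega>"
    using box_avg_T[OF _ \<omega>] length_in_box by (auto simp: G_def E_def)
  then obtain n where n: "\<And>x. x \<in> G \<Longrightarrow> n x \<le> N"
    "\<And>x. x \<in> G \<Longrightarrow> c < box_avg f x (n x) \<omega>"
    by metis
  have sub: "(\<Union>x\<in>G. lattice_box x (n x)) \<subseteq> ?B (K + N)"
  proof (intro UN_least subsetI)
    show "y \<in> ?B (K + N)" if "x \<in> G" "y \<in> lattice_box x (n x)" for x y
      using G(2)[OF that(1)] that(2) by (rule lattice_box_trans) (use n(1) that in simp)
  qed
  have "c * real (card G) \<le> 2 ^ d * (\<Sum>y\<in>(\<Union>x\<in>G. lattice_box x (n x)). f (T y \<omega>))"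
  proof (rule vitali_card_le_sum)
    show "c * real (card (lattice_box x (n x))) \<le> (\<Sum>y\<in>lattice_box x (n x). f (T y \<omega>))"
      if "x \<in> G" for x
      using n(2)[OF that] by (simp add: box_avg_def pos_less_divide_eq card_gt_0_iff)
  qed (use \<open>finite G\<close> G(1) f \<open>0 \<le> c\<close> in auto)
  also have "\<dots> \<le> 2 ^ d * (\<Sum>y\<in>?B (K + N). f (T y \<omega>))"
    using sub f by (intro mult_left_mono sum_mono2) auto
  finally have "c * real (card G) \<le> 2 ^ d * (\<Sum>y\<in>?B (K + N). f (T y \<omega>))" .
  moreover have "(\<Sum>x\<in>?B K. indicator E (T x \<omega>)) = real (card G)"
    by (simp add: G_def indicator_def sum.If_cases Int_def)
  ultimately show ?thesis by (simp add: box_avg_def box_ratio_def divide_right_mono)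
qed

lemma maximal_inequality_bounded:
  fixes c :: real
  assumes int: "integrable P f" and f: "\<And>\<omega>. 0 \<le> f \<omega>" and "0 \<le> c"
  shows "c * prob {\<omega>\<in>space P. \<exists>n\<le>N. c < box_avg f (origin d) n \<omega>} \<le> 2 ^ d * (\<integral>\<omega>. f \<omega> \<partial>P)"
proof -
  define E where "E = {\<omega>\<in>space P. \<exists>n\<le>N. c < box_avg f (origin d) n \<omega>}"
  note [measurable] = borel_measurable_box_avg[OF int]
  have E: "E \<in> sets P" unfolding E_def by measurable
  then have int_E: "integrable P (indicator E :: 'a \<Rightarrow> real)" by (simp add: emeasure_eq_measure)
  have bound: "c * prob E \<le> 2 ^ d * (box_ratio d N K * (\<integral>\<omega>. f \<omega> \<partial>P))" for K
  proof -
    have "c * prob E = (\<integral>\<omega>. c * box_avg (indicator E) (origin d) K \<omega> \<partial>P)"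
      using integral_box_avg[OF int_E] E by simp
    also have "\<dots> \<le> (\<integral>\<omega>. 2 ^ d * (box_ratio d N K * box_avg f (origin d) (K + N) \<omega>) \<partial>P)"
      using maximal_average_le[OF f \<open>0 \<le> c\<close> _ E_def, of _ K]
        integrable_box_avg[OF int] integrable_box_avg[OF int_E]
      by (intro integral_mono) auto
    also have "\<dots> = 2 ^ d * (box_ratio d N K * (\<integral>\<omega>. f \<omega> \<partial>P))" by (simp add: integral_box_avg[OF int])
    finally show ?thesis .
  qed
  have "(\<lambda>K. 2 ^ d * (box_ratio d N K * (\<integral>\<omega>. f \<omega> \<partial>P))) \<longlonglongrightarrow> 2 ^ d * (1 * (\<integral>\<omega>. f \<omega> \<partial>P))"
    by (intro tendsto_intros box_ratio_tendsto_1)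
  then have "c * prob E \<le> 2 ^ d * (1 * (\<integral>\<omega>. f \<omega> \<partial>P))"
    by (rule LIMSEQ_le_const) (use bound in blast)
  then show ?thesis by (simp add: E_def)
qed

lemma maximal_inequality:
  fixes c :: real
  assumes int: "integrable P f" and f: "\<And>\<omega>. 0 \<le> f \<omega>" and "0 \<le> c"
  shows "c * prob {\<omega>\<in>space P. \<exists>n. c < box_avg f (origin d) n \<omega>} \<le> 2 ^ d * (\<integral>\<omega>. f \<omega> \<partial>P)"
proof -
  define E where "E N = {\<omega>\<in>space P. \<exists>n\<le>N. c < box_avg f (origin d) n \<omega>}" for N :: nat
  note [measurable] = borel_measurable_box_avg[OF int]
  have "E N \<in> sets P" for N unfolding E_def by measurable
  moreover have "incseq E" unfolding incseq_def E_def using order_trans by blast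
  ultimately have "(\<lambda>N. c * prob (E N)) \<longlonglongrightarrow> c * prob (\<Union>N. E N)"
    by (intro tendsto_intros finite_Lim_measure_incseq) auto
  then have "c * prob (\<Union>N. E N) \<le> 2 ^ d * (\<integral>\<omega>. f \<omega> \<partial>P)"
    using maximal_inequality_bounded[OF int f \<open>0 \<le> c\<close>]
    by (intro LIMSEQ_le_const2) (auto simp: E_def)
  moreover have "(\<Union>N. E N) = {\<omega>\<in>space P. \<exists>n. c < box_avg f (origin d) n \<omega>}"
    unfolding E_def by blast
  ultimately show ?thesis by simp
qed

definition upper_avg :: "('a \<Rightarrow> real) \<Rightarrow> 'a \<Rightarrow> ereal" where
  "upper_avg f \<omega> = limsup (\<lambda>n. ereal (box_avg f (origin d) n \<omega>))"

lemma maximal_inequality_upper_avg: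
  fixes c :: real
  assumes int: "integrable P f" and f: "\<And>\<omega>. 0 \<le> f \<omega>" and "0 \<le> c"
  shows "c * prob {\<omega>\<in>space P. c < upper_avg f \<omega>} \<le> 2 ^ d * (\<integral>\<omega>. f \<omega> \<partial>P)"
proof -
  note [measurable] = borel_measurable_box_avg[OF int]
  have "\<exists>n. c < box_avg f (origin d) n \<omega>" if "c < upper_avg f \<omega>" for \<omega>
  proof (rule ccontr)
    assume "\<not> ?thesis"
    then have "upper_avg f \<omega> \<le> c"
      unfolding upper_avg_def by (intro Limsup_bounded always_eventually) (simp add: not_less)
    then show False using that by simp
  qed
  then have "prob {\<omega>\<in>space P. c < upper_avg f \<omega>}
      \<le> prob {\<omega>\<in>space P. \<exists>n. c < box_avg f (origin d) n \<omega>}"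
    by (intro finite_measure_mono) auto
  then have "c * prob {\<omega>\<in>space P. c < upper_avg f \<omega>}
      \<le> c * prob {\<omega>\<in>space P. \<exists>n. c < box_avg f (origin d) n \<omega>}"
    using \<open>0 \<le> c\<close> by (rule mult_left_mono)
  also have "\<dots> \<le> 2 ^ d * (\<integral>\<omega>. f \<omega> \<partial>P)" using int f \<open>0 \<le> c\<close> by (rule maximal_inequality)
  finally show ?thesis .
qed

lemma upper_avg_T_le:
  assumes f: "\<And>\<omega>. 0 \<le> f \<omega>" and x: "length x = d" and \<omega>: "\<omega> \<in> space P"
  shows "upper_avg f (T x \<omega>) \<le> upper_avg f \<omega>"
proof -
  obtain r where r: "x \<in> lattice_box (origin d) r" using ex_lattice_box_origin x by blast
  have "upper_avg f (T x \<omega>)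
      \<le> limsup (\<lambda>n. ereal (box_ratio d r n) * ereal (box_avg f (origin d) (n + r) \<omega>))"
    unfolding upper_avg_def box_avg_T[OF x \<omega>] using box_avg_le_ratio[OF f r]
    by (intro Limsup_mono always_eventually) simp
  also have "\<dots> = 1 * limsup (\<lambda>n. ereal (box_avg f (origin d) (n + r) \<omega>))"
    using box_ratio_tendsto_1[of d r]
    by (intro ereal_limsup_lim_mult) (auto simp: one_ereal_def)
  also have "\<dots> = upper_avg f \<omega>"
    unfolding upper_avg_def
    using limsup_shift_k[of "\<lambda>n. ereal (box_avg f (origin d) n \<omega>)" r] by simp
  finally show ?thesis .
qed

lemma upper_avg_T:
  assumes "\<And>\<omega>. 0 \<le> f \<omega>" and x: "length x = d" and \<omega>: "\<omega> \<in> space P"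
  shows "upper_avg f (T x \<omega>) = upper_avg f \<omega>"
proof (rule antisym)
  let ?y = "map uminus x"
  have "lattice_add x ?y = origin d" using x by (simp add: list_eq_iff_nth_eq)
  then have "T ?y (T x \<omega>) = \<omega>" using T_add[OF x _ \<omega>] T_origin[OF \<omega>] x by simp
  moreover have "upper_avg f (T ?y (T x \<omega>)) \<le> upper_avg f (T x \<omega>)"
    using assms(1) by (rule upper_avg_T_le) (use x T_space[OF x \<omega>] in simp_all)
  ultimately show "upper_avg f \<omega> \<le> upper_avg f (T x \<omega>)" by simp
qed (rule upper_avg_T_le[OF assms])

end

locale ergodic_lattice_action = lattice_action +
  assumes T_ergodic: "A \<in> sets P \<Longrightarrow> (\<And>x. length x = d \<Longrightarrow> T x -` A \<inter> space P = A) \<Longrightarrow>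
    prob A = 0 \<or> prob A = 1"
begin

lemma AE_upper_avg_le:
  assumes int: "integrable P f" and f: "\<And>\<omega>. 0 \<le> f \<omega>" and c: "2 ^ d * (\<integral>\<omega>. f \<omega> \<partial>P) < c"
  shows "AE \<omega> in P. upper_avg f \<omega> \<le> c"
proof -
  note [measurable] = borel_measurable_box_avg[OF int]
  have "0 \<le> (\<integral>\<omega>. f \<omega> \<partial>P)" using f by simp
  then have "0 \<le> 2 ^ d * (\<integral>\<omega>. f \<omega> \<partial>P)" by simp
  then have "0 \<le> c" using c by linarith
  define E where "E = {\<omega>\<in>space P. c < upper_avg f \<omega>}"
  have E: "E \<in> sets P" unfolding E_def upper_avg_def by measurable
  have "T x -` E \<inter> space P = E" if "length x = d" for x
    using upper_avg_T[OF f that] T_space[OF that] by (auto simp: E_def)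
  then have "prob E = 0 \<or> prob E = 1" using T_ergodic[OF E] by blast
  moreover have "c * prob E < c"
    using maximal_inequality_upper_avg[OF int f \<open>0 \<le> c\<close>] c unfolding E_def by linarith
  ultimately have "prob E = 0" by auto
  then have "AE \<omega> in P. \<omega> \<notin> E" using E by (simp add: prob_eq_0)
  then show ?thesis using AE_space by eventually_elim (auto simp: E_def)
qed

end

section \<open>Cubes entering between two levels\<close>

definition eint_mid :: "eint \<Rightarrow> real" where
  "eint_mid I = real_of_int (fst I) + (if snd I then 1/2 else 0)"

definition cube_mid :: "ecube \<Rightarrow> real list" where
  "cube_mid Q = map eint_mid Q"

definition eint_faces :: "eint \<Rightarrow> eint set" where
  "eint_faces I = (if snd I then {I, (fst I, False), (fst I + 1, False)} else {I})"

definition faces :: "ecube \<Rightarrow> ecube set" where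
  "faces R = listset (map eint_faces R)"

lemma in_faces_iff:
  "Q \<in> faces R \<longleftrightarrow> length Q = length R \<and> (\<forall>i<length R. Q ! i \<in> eint_faces (R ! i))"
  by (auto simp: faces_def in_listset_iff)

lemma finite_faces: "finite (faces R)"
  unfolding faces_def by (rule finite_listset) (auto simp: eint_faces_def)

lemma card_faces_le: "card (faces R) \<le> 3 ^ length R"
proof -
  have "card (eint_faces I) \<le> 3" for I
    using card_length[of "[I, (fst I, False), (fst I + 1, False)]"] by (simp add: eint_faces_def)
  then show ?thesis
    unfolding faces_def card_listset by (induction R) (simp_all add: mult_le_mono)
qed

lemma cube_mid_in_cube_set: "cube_mid Q \<in> cube_set Q"
  by (simp add: cube_mid_def cube_set_def eint_mid_def eint_set_def)

lemma eint_mid_in_imp_face: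
  assumes "eint_mid I \<in> eint_set J"
  shows "I \<in> eint_faces J"
proof (cases "snd I")
  case True
  then have mid: "real_of_int (fst I) + 1/2 \<in> eint_set J" using assms by (simp add: eint_mid_def)
  have "snd J"
  proof (rule ccontr)
    assume "\<not> snd J"
    then have "real_of_int (2 * fst I + 1) = real_of_int (2 * fst J)"
      using mid by (simp add: eint_set_def)
    then have "2 * fst I + 1 = 2 * fst J" unfolding of_int_eq_iff .
    then show False by presburger
  qed
  then have "fst I = fst J" using mid by (simp add: eint_set_def)
  then show ?thesis using True \<open>snd J\<close> by (simp add: eint_faces_def prod_eq_iff)
next
  case False
  then show ?thesis using assms
    by (auto simp: eint_mid_def eint_set_def eint_faces_def prod_eq_iff split: if_splits)
qed

lemma cube_mid_in_imp_face:
  assumes "cube_mid Q \<in> cube_set R"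
  shows "Q \<in> faces R"
  using assms by (auto simp: cube_mid_def cube_set_def in_faces_iff intro: eint_mid_in_imp_face)

lemma cube_set_face_subset:
  assumes "Q \<in> faces R"
  shows "cube_set Q \<subseteq> cube_set R"
proof -
  have "eint_set I \<subseteq> eint_set J" if "I \<in> eint_faces J" for I J
    using that by (auto simp: eint_faces_def eint_set_def split: if_splits)
  then have "eint_set (Q ! i) \<subseteq> eint_set (R ! i)" if "i < length R" for i
    using assms that by (simp add: in_faces_iff)
  then show ?thesis using assms by (auto simp: in_faces_iff cube_set_def)
qed

lemma cube_set_subset_Xt_iff:
  "cube_set Q \<subseteq> Xt d \<omega> t \<longleftrightarrow> (\<exists>R\<in>elem_cubes d. \<omega> R \<le> t \<and> Q \<in> faces R)"
proof
  assume "cube_set Q \<subseteq> Xt d \<omega> t"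
  then have "cube_mid Q \<in> Xt d \<omega> t" using cube_mid_in_cube_set by blast
  then show "\<exists>R\<in>elem_cubes d. \<omega> R \<le> t \<and> Q \<in> faces R"
    unfolding Xt_def by (auto intro: cube_mid_in_imp_face)
next
  assume "\<exists>R\<in>elem_cubes d. \<omega> R \<le> t \<and> Q \<in> faces R"
  then obtain R where "R \<in> elem_cubes d" "\<omega> R \<le> t" "cube_set Q \<subseteq> cube_set R"
    using cube_set_face_subset by blast
  then show "cube_set Q \<subseteq> Xt d \<omega> t" unfolding Xt_def by blast
qed

definition cubes_box :: "nat \<Rightarrow> nat \<Rightarrow> ecube set" where
  "cubes_box d n = {R. map fst R \<in> lattice_box (origin d) n}"

text \<open>Representatives of the elementary cubes modulo lattice translations.\<close>
definition corner_cubes :: "nat \<Rightarrow> ecube set" where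
  "corner_cubes d = {R. set R \<subseteq> {0} \<times> UNIV \<and> length R = d}"

lemma finite_corner_cubes: "finite (corner_cubes d)"
  unfolding corner_cubes_def by (intro finite_lists_length_eq) auto

lemma corner_cubes_subset: "corner_cubes d \<subseteq> elem_cubes d"
  by (auto simp: corner_cubes_def elem_cubes_def)

lemma length_shift_cube [simp]: "length (shift_cube x Q) = min (length Q) (length x)"
  by (simp add: shift_cube_def)

lemma nth_shift_cube [simp]:
  "i < length Q \<Longrightarrow> i < length x \<Longrightarrow> shift_cube x Q ! i = (fst (Q ! i) + x ! i, snd (Q ! i))"
  by (simp add: shift_cube_def)

lemma cubes_box_subset_shifts:
  "cubes_box d n \<subseteq>
    (\<lambda>(x, R). shift_cube (map uminus x) R) ` (lattice_box (origin d) n \<times> corner_cubes d)"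
    (is "_ \<subseteq> ?shifts")
proof
  fix Q assume "Q \<in> cubes_box d n"
  then have Q: "length Q = d" "\<And>i. i < d \<Longrightarrow> \<bar>fst (Q ! i)\<bar> \<le> int n"
    by (auto simp: cubes_box_def in_lattice_box_iff)
  let ?x = "map (\<lambda>I. - fst I) Q" and ?R = "map (\<lambda>I. (0 :: int, snd I)) Q"
  have "Q = shift_cube (map uminus ?x) ?R" by (simp add: list_eq_iff_nth_eq)
  moreover have "?x \<in> lattice_box (origin d) n" using Q by (simp add: in_lattice_box_iff)
  moreover have "?R \<in> corner_cubes d" using Q(1) by (auto simp: corner_cubes_def)
  ultimately show "Q \<in> ?shifts"
    by (intro image_eqI[of _ _ "(?x, ?R)"]) auto
qed

lemma finite_cubes_box: "finite (cubes_box d n)"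
  by (rule finite_subset[OF cubes_box_subset_shifts]) (simp add: finite_corner_cubes)

lemma subset_Lambda_imp_cubes_box:
  assumes "length Q = d" "cube_set Q \<subseteq> Lambda d n"
  shows "Q \<in> cubes_box d n"
proof -
  have "map (\<lambda>I. real_of_int (fst I)) Q \<in> cube_set Q" by (simp add: cube_set_def eint_set_def)
  then have "\<bar>real_of_int (fst (Q ! i))\<bar> \<le> real n" if "i < d" for i
    using that assms by (auto simp: Lambda_def)
  then have "real_of_int \<bar>fst (Q ! i)\<bar> \<le> real_of_int (int n)" if "i < d" for i using that by simp
  then have "\<bar>fst (Q ! i)\<bar> \<le> int n" if "i < d" for i using that unfolding of_int_le_iff by blast
  then show ?thesis using assms(1) by (simp add: cubes_box_def in_lattice_box_iff)
qed

lemma finite_cubes_in_Xn: "finite (cubes_in d (Xn d \<omega> n t) k)"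
  by (rule finite_subset[OF _ finite_cubes_box[of d n]])
    (auto simp: cubes_in_def elem_cubes_def Xn_def intro: subset_Lambda_imp_cubes_box)

lemma coface_in_cubes_box:
  assumes "Q \<in> faces R" "Q \<in> cubes_box d n"
  shows "R \<in> cubes_box d (Suc n)"
proof -
  have len: "length R = d" "length Q = d"
    using assms by (simp_all add: in_faces_iff cubes_box_def in_lattice_box_iff)
  have "\<bar>fst (R ! i)\<bar> \<le> int (Suc n)" if "i < d" for i
  proof -
    have "Q ! i \<in> eint_faces (R ! i)" "\<bar>fst (Q ! i)\<bar> \<le> int n"
      using assms len that by (auto simp: in_faces_iff cubes_box_def in_lattice_box_iff)
    then show ?thesis by (auto simp: eint_faces_def split: if_splits)
  qed
  then show ?thesis using len by (simp add: cubes_box_def in_lattice_box_iff)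
qed

definition level_cubes :: "nat \<Rightarrow> nat \<Rightarrow> real \<Rightarrow> real \<Rightarrow> (ecube \<Rightarrow> real) \<Rightarrow> ecube set" where
  "level_cubes d n s t \<omega> = {R \<in> cubes_box d n. \<omega> R \<in> {s<..t}}"

lemma finite_level_cubes: "finite (level_cubes d n s t \<omega>)"
  using finite_cubes_box by (simp add: level_cubes_def)

lemma new_cubes_subset_faces:
  "cubes_in d (Xn d \<omega> n t) k - cubes_in d (Xn d \<omega> n s) k
    \<subseteq> (\<Union>R\<in>level_cubes d (Suc n) s t \<omega>. faces R)"
proof
  fix Q assume "Q \<in> cubes_in d (Xn d \<omega> n t) k - cubes_in d (Xn d \<omega> n s) k"
  then have Q: "length Q = d" "cube_set Q \<subseteq> Lambda d n" "cube_set Q \<subseteq> Xt d \<omega> t"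
    and new: "\<not> cube_set Q \<subseteq> Xt d \<omega> s"
    by (auto simp: cubes_in_def elem_cubes_def Xn_def)
  obtain R where R: "R \<in> elem_cubes d" "\<omega> R \<le> t" "Q \<in> faces R"
    using Q(3) unfolding cube_set_subset_Xt_iff by blast
  have "s < \<omega> R" using new R(1,3) unfolding cube_set_subset_Xt_iff by force
  moreover have "R \<in> cubes_box d (Suc n)"
    using R(3) subset_Lambda_imp_cubes_box[OF Q(1,2)] by (rule coface_in_cubes_box)
  ultimately show "Q \<in> (\<Union>R\<in>level_cubes d (Suc n) s t \<omega>. faces R)"
    using R(2,3) by (auto simp: level_cubes_def)
qed

lemma card_new_cubes_le:
  "card (cubes_in d (Xn d \<omega> n t) k - cubes_in d (Xn d \<omega> n s) k)
     \<le> 3 ^ d * card (level_cubes d (Suc n) s t \<omega>)" (is "card ?D \<le> _ * card ?L")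
proof -
  have "card ?D \<le> card (\<Union>R\<in>?L. faces R)"
    using finite_level_cubes finite_faces by (intro card_mono new_cubes_subset_faces) auto
  also have "\<dots> \<le> (\<Sum>R\<in>?L. card (faces R))" using finite_level_cubes by (rule card_UN_le)
  also have "\<dots> \<le> (\<Sum>R\<in>?L. 3 ^ d)"
  proof (rule sum_mono)
    fix R assume "R \<in> ?L"
    then have "length R = d" by (simp add: level_cubes_def cubes_box_def in_lattice_box_iff)
    then show "card (faces R) \<le> 3 ^ d" using card_faces_le[of R] by simp
  qed
  finally show ?thesis by (simp add: mult.commute)
qed

lemma betti_n_diff_le:
  assumes "s \<le> t"
  shows "\<bar>betti_n d q \<omega> n t - betti_n d q \<omega> n s\<bar>
    \<le> 3 ^ d * real (card (level_cubes d (Suc n) s t \<omega>))"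
proof -
  have sub: "Xn d \<omega> n s \<subseteq> Xn d \<omega> n t" using assms unfolding Xn_def Xt_def by fastforce
  let ?D = "3 ^ d * card (level_cubes d (Suc n) s t \<omega>)"
  have "betti d (Xn d \<omega> n t) q \<le> betti d (Xn d \<omega> n s) q + ?D"
    using betti_superset_le[OF sub finite_cubes_in_Xn, of q] card_new_cubes_le[of d \<omega> n t q s]
    by linarith
  moreover have "betti d (Xn d \<omega> n s) q \<le> betti d (Xn d \<omega> n t) q + ?D"
    using betti_subset_le[OF sub finite_cubes_in_Xn finite_cubes_in_Xn, of q]
      card_new_cubes_le[of d \<omega> n t "Suc q" s] by linarith
  ultimately have "\<bar>betti_n d q \<omega> n t - betti_n d q \<omega> n s\<bar> \<le> real ?D"
    unfolding betti_n_def by linarith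
  then show ?thesis by simp
qed

definition corner_count :: "nat \<Rightarrow> real \<Rightarrow> real \<Rightarrow> (ecube \<Rightarrow> real) \<Rightarrow> real" where
  "corner_count d s t \<omega> = (\<Sum>R\<in>corner_cubes d. indicator {s<..t} (\<omega> R))"

lemma corner_count_nonneg: "0 \<le> corner_count d s t \<omega>"
  by (simp add: corner_count_def sum_nonneg)

lemma card_level_cubes_le:
  "real (card (level_cubes d n s t \<omega>))
    \<le> (\<Sum>x\<in>lattice_box (origin d) n. corner_count d s t (tau d x \<omega>))"
proof -
  let ?S = "lattice_box (origin d) n \<times> corner_cubes d"
  let ?h = "\<lambda>(x, R). shift_cube (map uminus x) R"
  let ?L = "{p \<in> ?S. \<omega> (?h p) \<in> {s<..t}}"
  have fin: "finite ?S" by (simp add: finite_corner_cubes)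
  have "level_cubes d n s t \<omega> \<subseteq> ?h ` ?L"
    using cubes_box_subset_shifts[of d n] unfolding level_cubes_def by blast
  then have "card (level_cubes d n s t \<omega>) \<le> card ?L"
    using fin by (intro surj_card_le) auto
  then have "real (card (level_cubes d n s t \<omega>)) \<le> real (card ?L)" by simp
  also have "\<dots> = (\<Sum>p\<in>?S. indicator {s<..t} (\<omega> (?h p)))"
    using fin by (simp add: indicator_def sum.If_cases Int_def)
  also have "\<dots> = (\<Sum>x\<in>lattice_box (origin d) n. \<Sum>R\<in>corner_cubes d.
      indicator {s<..t} (\<omega> (shift_cube (map uminus x) R)))"
    by (simp add: sum.cartesian_product case_prod_beta)
  also have "\<dots> = (\<Sum>x\<in>lattice_box (origin d) n. corner_count d s t (tau d x \<omega>))"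
    unfolding corner_count_def using corner_cubes_subset[of d]
    by (intro sum.cong refl) (auto simp: tau_def)
  finally show ?thesis .
qed

section \<open>Uniform convergence\<close>

lemma eventually_uniformly_close_of_net:
  fixes f :: "'n \<Rightarrow> 'a \<Rightarrow> 'b::metric_space"
  assumes "finite I" and cover: "S \<subseteq> (\<Union>i\<in>I. J i)" and "0 < e"
    and osc_f: "\<And>i. i \<in> I \<Longrightarrow> \<forall>\<^sub>F n in F. \<forall>t\<in>J i. dist (f n t) (f n (p i)) \<le> e"
    and osc_g: "\<And>i t. i \<in> I \<Longrightarrow> t \<in> J i \<Longrightarrow> dist (g t) (g (p i)) \<le> e"
    and lim: "\<And>i. i \<in> I \<Longrightarrow> ((\<lambda>n. f n (p i)) \<longlongrightarrow> g (p i)) F"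
  shows "\<forall>\<^sub>F n in F. \<forall>t\<in>S. dist (f n t) (g t) < 3 * e"
proof -
  have "\<forall>\<^sub>F n in F. \<forall>i\<in>I. \<forall>t\<in>J i. dist (f n t) (f n (p i)) \<le> e"
    using \<open>finite I\<close> osc_f by (intro eventually_ball_finite) auto
  moreover have "\<forall>\<^sub>F n in F. \<forall>i\<in>I. dist (f n (p i)) (g (p i)) < e"
    using \<open>finite I\<close> tendstoD[OF lim \<open>0 < e\<close>] by (intro eventually_ball_finite) auto
  ultimately show ?thesis
  proof (eventually_elim, intro ballI)
    fix n t assume f: "\<forall>i\<in>I. \<forall>t\<in>J i. dist (f n t) (f n (p i)) \<le> e"
      and g: "\<forall>i\<in>I. dist (f n (p i)) (g (p i)) < e" and "t \<in> S"
    then obtain i where i: "i \<in> I" "t \<in> J i" using cover by blast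
    have "dist (f n t) (f n (p i)) \<le> e" "dist (f n (p i)) (g (p i)) < e" using f g i by blast+
    then show "dist (f n t) (g t) < 3 * e"
      using osc_g[OF i] dist_triangle[of "f n t" "g t" "f n (p i)"]
        dist_triangle2[of "f n (p i)" "g t" "g (p i)"] by linarith
  qed
qed

lemma continuous_on_Icc_small_increments:
  fixes g :: "real \<Rightarrow> real"
  assumes cont: "continuous_on {a..b} g" and "0 < e"
  obtains I where "finite I" "{a..b} \<subseteq> (\<Union>(s, u)\<in>I. {s..u})"
    "\<And>s u. (s, u) \<in> I \<Longrightarrow> a \<le> s \<and> s \<le> u \<and> u \<le> b \<and> g u - g s < e"
proof -
  have "\<exists>\<delta>>0. \<forall>y\<in>{a..b}. dist y x \<le> \<delta> \<longrightarrow> dist (g y) (g x) < e / 2" if x: "x \<in> {a..b}" for x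
  proof -
    obtain \<delta> where "0 < \<delta>" "\<forall>y\<in>{a..b}. dist y x < \<delta> \<longrightarrow> dist (g y) (g x) < e / 2"
      using cont x half_gt_zero[OF \<open>0 < e\<close>] unfolding continuous_on_iff by blast
    then show ?thesis by (intro exI[of _ "\<delta> / 2"]) auto
  qed
  then obtain \<delta> where \<delta>: "\<And>x. x \<in> {a..b} \<Longrightarrow> 0 < \<delta> x"
    "\<And>x y. x \<in> {a..b} \<Longrightarrow> y \<in> {a..b} \<Longrightarrow> dist y x \<le> \<delta> x \<Longrightarrow> dist (g y) (g x) < e / 2"
    by metis
  have "{a..b} \<subseteq> (\<Union>x\<in>{a..b}. ball x (\<delta> x))" using \<delta>(1) by force
  then obtain C where C: "C \<subseteq> {a..b}" "finite C" "{a..b} \<subseteq> (\<Union>x\<in>C. ball x (\<delta> x))"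
    by (rule compactE_image[OF compact_Icc, rotated]) auto
  let ?s = "\<lambda>x. max a (x - \<delta> x)" and ?u = "\<lambda>x. min b (x + \<delta> x)"
  show thesis
  proof (rule that[of "(\<lambda>x. (?s x, ?u x)) ` C"])
    show "{a..b} \<subseteq> (\<Union>(s, u)\<in>(\<lambda>x. (?s x, ?u x)) ` C. {s..u})"
    proof
      fix y assume y: "y \<in> {a..b}"
      then obtain x where "x \<in> C" "y \<in> ball x (\<delta> x)" using C(3) by blast
      then show "y \<in> (\<Union>(s, u)\<in>(\<lambda>x. (?s x, ?u x)) ` C. {s..u})"
        using y by (auto simp: dist_real_def intro!: bexI[of _ x])
    qed
    fix s u assume "(s, u) \<in> (\<lambda>x. (?s x, ?u x)) ` C"
    then obtain x where x: "x \<in> {a..b}" and su: "s = ?s x" "u = ?u x" using C(1) by blast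
    have "dist (g s) (g x) < e / 2" "dist (g u) (g x) < e / 2"
      using \<delta>(1)[OF x] x unfolding su by (intro \<delta>(2) x; auto simp: dist_real_def)+
    then have "g u - g s < e" unfolding dist_real_def by linarith
    then show "a \<le> s \<and> s \<le> u \<and> u \<le> b \<and> g u - g s < e"
      using \<delta>(1)[OF x] x unfolding su by auto
  qed (simp add: C(2))
qed

lemma uniform_limit_imp_SUP_dist_tendsto_0:
  assumes "uniform_limit S f l F" "S \<noteq> {}"
  shows "((\<lambda>n. SUP x\<in>S. dist (f n x) (l x)) \<longlongrightarrow> 0) F"
proof (rule tendstoI)
  fix e :: real assume "0 < e"
  then have "\<forall>\<^sub>F n in F. \<forall>x\<in>S. dist (f n x) (l x) < e / 2"
    using uniform_limitD[OF assms(1)] half_gt_zero by blast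
  then show "\<forall>\<^sub>F n in F. dist (SUP x\<in>S. dist (f n x) (l x)) 0 < e"
  proof eventually_elim
    fix n assume close: "\<forall>x\<in>S. dist (f n x) (l x) < e / 2"
    then have "(SUP x\<in>S. dist (f n x) (l x)) \<le> e / 2"
      using assms(2) by (intro cSUP_least) auto
    moreover have "0 \<le> (SUP x\<in>S. dist (f n x) (l x))"
    proof -
      obtain x where "x \<in> S" using assms(2) by blast
      have "bdd_above ((\<lambda>x. dist (f n x) (l x)) ` S)"
        using close by (intro bdd_aboveI2[of _ _ "e / 2"]) auto
      then have "dist (f n x) (l x) \<le> (SUP x\<in>S. dist (f n x) (l x))"
        using \<open>x \<in> S\<close> by (intro cSUP_upper)
      then show ?thesis using zero_le_dist order_trans by blast
    qed
    ultimately show "dist (SUP x\<in>S. dist (f n x) (l x)) 0 < e" using \<open>0 < e\<close> by simp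
  qed
qed

lemma shift_cube_shift_cube:
  assumes "length x = length Q" "length y = length Q"
  shows "shift_cube x (shift_cube y Q) = shift_cube (lattice_add x y) Q"
  using assms by (simp add: list_eq_iff_nth_eq)

lemma map_uminus_lattice_add:
  "map uminus (lattice_add x y) = lattice_add (map uminus x) (map uminus y)"
  by (simp add: list_eq_iff_nth_eq)

lemma card_lattice_box_le_vol_Lambda:
  assumes "1 \<le> n"
  shows "real (card (lattice_box (origin d) (Suc n))) \<le> 3 ^ d * vol_Lambda d n"
proof -
  have "real (card (lattice_box (origin d) (Suc n))) = (2 * real n + 3) ^ d"
    by (simp add: card_lattice_box add.commute)
  also have "\<dots> \<le> (3 * (2 * real n)) ^ d" using assms by (intro power_mono) auto
  finally show ?thesis unfolding vol_Lambda_def by (simp only: power_mult_distrib)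
qed

abbreviation betti_density :: "nat \<Rightarrow> nat \<Rightarrow> (ecube \<Rightarrow> real) \<Rightarrow> nat \<Rightarrow> real \<Rightarrow> real" where
  "betti_density d q \<omega> n t \<equiv> betti_n d q \<omega> n t / vol_Lambda d n"

locale stationary_ergodic_cubes = prob_space P for d :: nat and P :: "(ecube \<Rightarrow> real) measure" +
  assumes sets_P: "sets P = sets (Omega d)"
    and stationary: "stationary d P" and ergodic: "ergodic d P"
begin

lemma space_P: "space P = (\<Pi>\<^sub>E Q\<in>elem_cubes d. {0..1})"
  using sets_eq_imp_space_eq[OF sets_P] by (simp add: Omega_def space_PiM)

lemma measurable_tau:
  assumes "length x = d"
  shows "tau d x \<in> measurable P P"
proof -
  have shift: "shift_cube (map uminus x) Q \<in> elem_cubes d" if "Q \<in> elem_cubes d" for Q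
    using that assms by (simp add: elem_cubes_def)
  have "tau d x \<in> measurable (Omega d) (Omega d)"
    unfolding Omega_def tau_def
  proof (rule measurable_PiM_single')
    fix Q assume "Q \<in> elem_cubes d"
    then show "(\<lambda>\<omega>. if Q \<in> elem_cubes d then \<omega> (shift_cube (map uminus x) Q) else undefined)
      \<in> measurable (Pi\<^sub>M (elem_cubes d) (\<lambda>_. restrict_space borel {0..1}))
        (restrict_space borel {0..1})"
      using measurable_component_singleton[OF shift] by simp
  qed (use shift in \<open>auto simp: space_PiM PiE_iff extensional_def\<close>)
  then show ?thesis using measurable_cong_sets[OF sets_P sets_P] by simp
qed

lemma measurable_component:
  assumes "Q \<in> elem_cubes d"
  shows "(\<lambda>\<omega>. \<omega> Q) \<in> borel_measurable P"
proof -
  have "(\<lambda>\<omega>. \<omega> Q) \<in> measurable (Omega d) (restrict_space borel {0..1::real})"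
    unfolding Omega_def using assms by (rule measurable_component_singleton)
  then have "(\<lambda>\<omega>. \<omega> Q) \<in> borel_measurable (Omega d)"
    by (simp add: measurable_restrict_space2_iff)
  then show ?thesis using measurable_cong_sets[OF sets_P refl] by blast
qed

sublocale ergodic_lattice_action P d "tau d"
proof
  show "tau d x \<in> measurable P P" if "length x = d" for x using that by (rule measurable_tau)
  show "distr P P (tau d x) = P" if x: "length x = d" for x
  proof (rule measure_eqI)
    show "emeasure (distr P P (tau d x)) A = emeasure P A"
      if "A \<in> sets (distr P P (tau d x))" for A
      using that stationary x measurable_tau[OF x] by (simp add: emeasure_distr stationary_def)
  qed simp
  show "tau d (origin d) \<omega> = \<omega>" if "\<omega> \<in> space P" for \<omega>
  proof
    fix Q
    have "shift_cube (map uminus (origin d)) Q = Q" if "Q \<in> elem_cubes d"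
      using that by (simp add: elem_cubes_def list_eq_iff_nth_eq)
    then show "tau d (origin d) \<omega> Q = \<omega> Q"
      using that by (auto simp: tau_def space_P PiE_def extensional_def)
  qed
  show "tau d y (tau d x \<omega>) = tau d (lattice_add x y) \<omega>"
    if "length x = d" "length y = d" for x y \<omega>
    using that
    by (auto simp: tau_def fun_eq_iff elem_cubes_def shift_cube_shift_cube map_uminus_lattice_add)
  show "prob A = 0 \<or> prob A = 1"
    if "A \<in> sets P" "\<And>x. length x = d \<Longrightarrow> tau d x -` A \<inter> space P = A" for A
    using ergodic that unfolding ergodic_def by blast
qed

definition marginal_sum :: "real \<Rightarrow> real" where
  "marginal_sum t = (\<Sum>R\<in>corner_cubes d. prob {\<omega>\<in>space P. \<omega> R \<le> t})"

lemma has_bochner_integral_corner_count: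
  assumes "s \<le> t"
  shows "has_bochner_integral P (corner_count d s t) (marginal_sum t - marginal_sum s)"
proof -
  have "has_bochner_integral P (\<lambda>\<omega>. indicator {s<..t} (\<omega> R) :: real)
      (prob {\<omega>\<in>space P. \<omega> R \<le> t} - prob {\<omega>\<in>space P. \<omega> R \<le> s})" if R: "R \<in> corner_cubes d" for R
  proof -
    have [measurable]: "(\<lambda>\<omega>. \<omega> R) \<in> borel_measurable P"
      using corner_cubes_subset R by (intro measurable_component) blast
    let ?A = "{\<omega>\<in>space P. \<omega> R \<le> t} - {\<omega>\<in>space P. \<omega> R \<le> s}"
    have "has_bochner_integral P (indicator ?A :: _ \<Rightarrow> real) (prob ?A)"
      by (rule has_bochner_integral_real_indicator) (auto simp: emeasure_eq_measure)
    moreover have "prob ?A = prob {\<omega>\<in>space P. \<omega> R \<le> t} - prob {\<omega>\<in>space P. \<omega> R \<le> s}"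
      using assms by (intro finite_measure_Diff) auto
    moreover have "has_bochner_integral P (\<lambda>\<omega>. indicator {s<..t} (\<omega> R) :: real) v
        \<longleftrightarrow> has_bochner_integral P (indicator ?A :: _ \<Rightarrow> real) v" for v
      by (rule has_bochner_integral_cong) (auto simp: indicator_def)
    ultimately show ?thesis by simp
  qed
  then have "has_bochner_integral P (corner_count d s t) (\<Sum>R\<in>corner_cubes d.
      prob {\<omega>\<in>space P. \<omega> R \<le> t} - prob {\<omega>\<in>space P. \<omega> R \<le> s})"
    unfolding corner_count_def[abs_def] by (rule has_bochner_integral_sum)
  then show ?thesis by (simp add: marginal_sum_def sum_subtractf)
qed

text \<open>One factor \<open>3 ^ d\<close> bounds the number of faces of a cube, the other absorbs the enlargement of
the window by one.\<close>
lemma dist_betti_density_le_box_avg: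
  assumes n: "1 \<le> n" and t: "t \<in> {s..u}"
  shows "dist (betti_density d q \<omega> n t) (betti_density d q \<omega> n s)
    \<le> 9 ^ d * box_avg (corner_count d s u) (origin d) (Suc n) \<omega>"
proof -
  let ?B = "lattice_box (origin d) (Suc n)"
    and ?A = "box_avg (corner_count d s u) (origin d) (Suc n) \<omega>"
  have vol: "0 < vol_Lambda d n" using n by (simp add: vol_Lambda_def)
  have A: "0 \<le> ?A" by (simp add: box_avg_def corner_count_nonneg sum_nonneg)
  have "level_cubes d (Suc n) s t \<omega> \<subseteq> level_cubes d (Suc n) s u \<omega>"
    using t by (auto simp: level_cubes_def)
  then have "real (card (level_cubes d (Suc n) s t \<omega>))
      \<le> real (card (level_cubes d (Suc n) s u \<omega>))"
    by (intro of_nat_mono card_mono finite_level_cubes)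
  also have "\<dots> \<le> (\<Sum>x\<in>?B. corner_count d s u (tau d x \<omega>))" by (rule card_level_cubes_le)
  also have "\<dots> = real (card ?B) * ?A" by (simp add: box_avg_def)
  also have "\<dots> \<le> 3 ^ d * vol_Lambda d n * ?A"
    using card_lattice_box_le_vol_Lambda[OF n] A by (rule mult_right_mono)
  finally have count: "real (card (level_cubes d (Suc n) s t \<omega>)) \<le> 3 ^ d * vol_Lambda d n * ?A" .
  have "\<bar>betti_n d q \<omega> n t - betti_n d q \<omega> n s\<bar>
      \<le> 3 ^ d * real (card (level_cubes d (Suc n) s t \<omega>))"
    using t by (intro betti_n_diff_le) simp
  also have "\<dots> \<le> 3 ^ d * (3 ^ d * vol_Lambda d n * ?A)" using count by (rule mult_left_mono) simp
  also have "\<dots> = 9 ^ d * ?A * vol_Lambda d n" by (simp flip: power_mult_distrib)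
  finally show ?thesis
    using vol by (simp add: dist_real_def pos_divide_le_eq flip: diff_divide_distrib)
qed

lemma AE_eventually_betti_density_oscillation_le:
  assumes "s \<le> u" and small: "marginal_sum u - marginal_sum s < e"
  shows "AE \<omega> in P. \<forall>\<^sub>F n in sequentially. \<forall>t\<in>{s..u}.
    dist (betti_density d q \<omega> n t) (betti_density d q \<omega> n s) \<le> 18 ^ d * e"
proof -
  note count = has_bochner_integral_corner_count[OF \<open>s \<le> u\<close>, unfolded has_bochner_integral_iff]
  obtain c where c: "2 ^ d * (marginal_sum u - marginal_sum s) < c" "c < 2 ^ d * e"
    using dense[of "2 ^ d * (marginal_sum u - marginal_sum s)" "2 ^ d * e"] small by auto
  have "AE \<omega> in P. upper_avg (corner_count d s u) \<omega> \<le> c"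
    by (rule AE_upper_avg_le) (use count corner_count_nonneg c(1) in auto)
  then show ?thesis
  proof eventually_elim
    fix \<omega> assume "upper_avg (corner_count d s u) \<omega> \<le> c"
    also have "ereal c < ereal (2 ^ d * e)" using c(2) by simp
    finally have "upper_avg (corner_count d s u) \<omega> < ereal (2 ^ d * e)" .
    then have "\<forall>\<^sub>F n in sequentially. box_avg (corner_count d s u) (origin d) n \<omega> < 2 ^ d * e"
      unfolding upper_avg_def by (auto dest: Limsup_lessD)
    then have "\<forall>\<^sub>F n in sequentially.
        box_avg (corner_count d s u) (origin d) (Suc n) \<omega> < 2 ^ d * e"
      by (subst eventually_sequentially_Suc)
    then show "\<forall>\<^sub>F n in sequentially. \<forall>t\<in>{s..u}.
      dist (betti_density d q \<omega> n t) (betti_density d q \<omega> n s) \<le> 18 ^ d * e"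
      using eventually_ge_at_top[of 1]
    proof (eventually_elim, intro ballI)
      fix n t assume avg: "box_avg (corner_count d s u) (origin d) (Suc n) \<omega> < 2 ^ d * e"
        and "1 \<le> n" "t \<in> {s..u}"
      then have "dist (betti_density d q \<omega> n t) (betti_density d q \<omega> n s)
          \<le> 9 ^ d * box_avg (corner_count d s u) (origin d) (Suc n) \<omega>"
        by (intro dist_betti_density_le_box_avg)
      also have "\<dots> \<le> 9 ^ d * (2 ^ d * e)" using avg by (intro mult_left_mono) auto
      also have "\<dots> = 18 ^ d * e" by (simp flip: power_mult_distrib mult.assoc)
      finally show "dist (betti_density d q \<omega> n t) (betti_density d q \<omega> n s) \<le> 18 ^ d * e" .
    qed
  qed
qed

lemma dist_limit_betti_density_le:
  assumes "t \<in> {s..u}" and small: "marginal_sum u - marginal_sum s < e"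
    and lim_t: "AE \<omega> in P. (\<lambda>n. betti_density d q \<omega> n t) \<longlonglongrightarrow> b"
    and lim_s: "AE \<omega> in P. (\<lambda>n. betti_density d q \<omega> n s) \<longlonglongrightarrow> b'"
  shows "dist b b' \<le> 18 ^ d * e"
proof -
  have "s \<le> u" using assms(1) by simp
  have "AE \<omega> in P. dist b b' \<le> 18 ^ d * e"
    using AE_eventually_betti_density_oscillation_le[OF \<open>s \<le> u\<close> small] lim_t lim_s
  proof eventually_elim
    fix \<omega>
    assume osc: "\<forall>\<^sub>F n in sequentially. \<forall>t\<in>{s..u}.
        dist (betti_density d q \<omega> n t) (betti_density d q \<omega> n s) \<le> 18 ^ d * e"
      and "(\<lambda>n. betti_density d q \<omega> n t) \<longlonglongrightarrow> b" "(\<lambda>n. betti_density d q \<omega> n s) \<longlonglongrightarrow> b'"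
    then have "(\<lambda>n. dist (betti_density d q \<omega> n t) (betti_density d q \<omega> n s)) \<longlonglongrightarrow> dist b b'"
      by (intro tendsto_dist)
    moreover have "\<forall>\<^sub>F n in sequentially.
        dist (betti_density d q \<omega> n t) (betti_density d q \<omega> n s) \<le> 18 ^ d * e"
      using osc by eventually_elim (use assms(1) in blast)
    ultimately show "dist b b' \<le> 18 ^ d * e" by (rule tendsto_upperbound) simp
  qed
  then show ?thesis by simp
qed

lemma AE_eventually_betti_density_uniformly_close:
  assumes cont: "continuous_on {0..1} marginal_sum"
    and lim: "\<And>t. t \<in> {0..1} \<Longrightarrow> AE \<omega> in P. (\<lambda>n. betti_density d q \<omega> n t) \<longlonglongrightarrow> bhat t"
    and "0 < e"
  shows "AE \<omega> in P. \<forall>\<^sub>F n in sequentially. \<forall>t\<in>{0..1}. dist (betti_density d q \<omega> n t) (bhat t) < e"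
proof -
  define c where "c = e / (3 * 18 ^ d)"
  have c: "0 < c" "3 * (18 ^ d * c) = e" using \<open>0 < e\<close> by (simp_all add: c_def)
  obtain I where I: "finite I" "{0..1} \<subseteq> (\<Union>(s, u)\<in>I. {s..u})"
    "\<And>s u. (s, u) \<in> I \<Longrightarrow> 0 \<le> s \<and> s \<le> u \<and> u \<le> 1 \<and> marginal_sum u - marginal_sum s < c"
    using continuous_on_Icc_small_increments[OF cont c(1)] by blast
  have osc_bhat: "dist (bhat t) (bhat s) \<le> 18 ^ d * c" if "(s, u) \<in> I" "t \<in> {s..u}" for s u t
  proof -
    have "s \<in> {0..1}" "t \<in> {0..1}" "marginal_sum u - marginal_sum s < c"
      using I(3)[OF that(1)] that(2) by auto
    then show ?thesis using that(2) lim by (intro dist_limit_betti_density_le[of t s u c q])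
  qed
  have "AE \<omega> in P. \<forall>(s, u)\<in>I. \<forall>\<^sub>F n in sequentially. \<forall>t\<in>{s..u}.
      dist (betti_density d q \<omega> n t) (betti_density d q \<omega> n s) \<le> 18 ^ d * c"
    using I(1,3)
    by (intro AE_finite_allI) (auto intro: AE_eventually_betti_density_oscillation_le)
  moreover have "AE \<omega> in P. \<forall>(s, u)\<in>I. (\<lambda>n. betti_density d q \<omega> n s) \<longlonglongrightarrow> bhat s"
    using I(1,3) by (intro AE_finite_allI) (fastforce intro: lim)+
  ultimately show ?thesis
  proof eventually_elim
    case (elim \<omega>)
    have "\<forall>\<^sub>F n in sequentially. \<forall>t\<in>{0..1}.
        dist (betti_density d q \<omega> n t) (bhat t) < 3 * (18 ^ d * c)"
      by (rule eventually_uniformly_close_of_net[where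
            I = I and p = fst and J = "\<lambda>(s, u). {s..u}"])
        (use I(1,2) c(1) elim osc_bhat in auto)
    then show ?case unfolding c(2) .
  qed
qed

lemma AE_uniform_limit_betti_density:
  assumes "continuous_on {0..1} marginal_sum"
    and "\<And>t. t \<in> {0..1} \<Longrightarrow> AE \<omega> in P. (\<lambda>n. betti_density d q \<omega> n t) \<longlonglongrightarrow> bhat t"
  shows "AE \<omega> in P. uniform_limit {0..1} (betti_density d q \<omega>) bhat sequentially"
proof -
  have "AE \<omega> in P. \<forall>j. \<forall>\<^sub>F n in sequentially. \<forall>t\<in>{0..1}.
      dist (betti_density d q \<omega> n t) (bhat t) < 1 / real (Suc j)"
    unfolding AE_all_countable
    by (intro allI AE_eventually_betti_density_uniformly_close[OF assms]) auto
  then show ?thesis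
  proof eventually_elim
    case (elim \<omega>)
    show ?case
      unfolding uniform_limit_iff
    proof (intro allI impI)
      fix e :: real assume "0 < e"
      then obtain j where j: "1 / real (Suc j) < e" using nat_approx_posE by blast
      from elim have "\<forall>\<^sub>F n in sequentially. \<forall>t\<in>{0..1}.
          dist (betti_density d q \<omega> n t) (bhat t) < 1 / real (Suc j)" ..
      then show "\<forall>\<^sub>F n in sequentially. \<forall>t\<in>{0..1}. dist (betti_density d q \<omega> n t) (bhat t) < e"
        by eventually_elim (use j in force)
    qed
  qed
qed

end

theorem theorem2p9:
  fixes d q :: nat and P :: "(ecube \<Rightarrow> real) measure" and bhat :: "real \<Rightarrow> real"
  assumes "prob_space P"
    and "sets P = sets (Omega d)"
    and "stationary d P" and "ergodic d P"
    and "q < d"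
    and "\<forall>t\<in>{0..1}. AE \<omega> in P.
           (\<lambda>n. betti_n d q \<omega> n t / vol_Lambda d n) \<longlonglongrightarrow> bhat t"
    and "\<forall>Q\<in>elem_cubes d. continuous_on {0..1} (\<lambda>t. measure P {\<omega>\<in>space P. \<omega> Q \<le> t})"
  shows "AE \<omega> in P. (\<lambda>n. SUP t\<in>{0..1}. \<bar>betti_n d q \<omega> n t / vol_Lambda d n - bhat t\<bar>)
           \<longlonglongrightarrow> 0"
proof -
  interpret stationary_ergodic_cubes d P
    using assms(1-4)
    by (simp add: stationary_ergodic_cubes_def stationary_ergodic_cubes_axioms_def)
  have "continuous_on {0..1} marginal_sum"
    unfolding marginal_sum_def using assms(7) corner_cubes_subset
    by (intro continuous_on_sum) blast
  then have "AE \<omega> in P. uniform_limit {0..1} (betti_density d q \<omega>) bhat sequentially"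
    using assms(6) by (intro AE_uniform_limit_betti_density) auto
  then show ?thesis
    by eventually_elim
      (use uniform_limit_imp_SUP_dist_tendsto_0 in \<open>fastforce simp: dist_real_def\<close>)
qed

end
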